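(* Let $\mathcal{A}$ be a bicomplete preorder, and let $\mathcal{F},\mathcal{C}$ be subsets of $\mathcal{A}$. Then there exists a model structure on $\mathcal{A}$ whose fibrant objects are precisely the members of $\mathcal{F}$, and whose cofibrant objects are precisely the members of $\mathcal{C}$, if and only if all of the following conditions are satisfied: 1. $\mathcal{F}$ and $\mathcal{C}$ are each closed under isomorphism in $\mathcal{A}$. 2. $\mathcal{F}$ is reflective, i.e., for each $x\in\mathcal{A}$, the set of upper bounds for $x$ which lie in $\mathcal{F}$ has a least element. 3. $\mathcal{C}$ is coreflective, i.e., for each $x\in\mathcal{A}$, the set of lower bounds for $x$ which lie in $\mathcal{C}$ has a greatest element. 4. If $x\in\mathcal{A}$, $f\in\mathcal{F}$ and $c\in\mathcal{C}$ are such that $f$ is minimal among members of $\mathcal{F}$ which are greater than or equal to every lower bound for $x$ in $\mathcal{C}$, and $c$ is maximal among members of $\mathcal{C}$ which are less than or equal to every upper bound for $x$ in $\mathcal{F}$, then $f\cong c$, i.e., $f\leq c\leq f$. 5. If $x,y\in\mathcal{A}$ are such that $x$ is less than or equal to some lower bound for $y$ in $\mathcal{C}$, and $y$ is greater than or equal to some upper bound for $x$ in $\mathcal{F}$, then some upper bound for $x$ in $\mathcal{F}$ is less than or equal to some lower bound for $y$ in $\mathcal{C}$. If such a model structure on $\mathcal{A}$ indeed exists, then its homotopy category is precisely the sub-preorder $\mathcal{F}\cap\mathcal{C}$ of $\mathcal{A}$.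
   Context: A preorder (a set with a reflexive transitive relation $\leq$) is regarded as a small category with exactly one morphism $X\to Y$ if $X\leq Y$ and none otherwise; $X\cong Y$ means $X\leq Y\leq X$. A bicomplete preorder is one having all small limits and colimits; $0$ and $1$ denote an initial and a terminal object. An upper bound for $x$ is an element $y$ with $x\leq y$; a lower bound for $x$ is an element $y$ with $y\leq x$. Least, greatest, minimal and maximal elements are understood up to isomorphism. A weak factorization system is a pair $(\mathcal{L},\mathcal{R})$ of classes of morphisms such that every morphism factors as a map in $\mathcal{L}$ followed by a map in $\mathcal{R}$, $\mathcal{L}$ is the class of maps with the left lifting property with respect to $\mathcal{R}$, and $\mathcal{R}$ is the class of maps with the right lifting property with respect to $\mathcal{L}$. A model structure is a triple $(\mathrm{cof},\mathrm{we},\mathrm{fib})$ of retract-closed subcategories containing all objects (cofibrations, weak equivalences, fibrations) such that $(\mathrm{cof}\cap \mathrm{we},\mathrm{fib})$ and $(\mathrm{cof},\mathrm{we}\cap \mathrm{fib})$ are weak factorization systems and $\mathrm{we}$ has the two-out-of-three property. An object $X$ is fibrant if $X\to 1$ is a fibration and cofibrant if $0\to X$ is a cofibration. The homotopy category is the localization of the category at the weak equivalences; as usual it is understood up to equivalence of categories, the identification with $\mathcal{F}\cap\mathcal{C}$ being as the full subcategory of objects which are both fibrant and cofibrant. *)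

theory Defs
  imports Main
begin

section \<open>Categories, functors, equivalences\<close>

text \<open>
  \<open>Comp K g f\<close> is the composite "first \<open>f\<close>, then \<open>g\<close>".
  The values of the operations outside \<open>Obj K\<close> and \<open>Arr K\<close> are irrelevant.
\<close>

record ('o, 'm) cat =
  Obj :: "'o set"
  Arr :: "'m set"
  Dom :: "'m \<Rightarrow> 'o"
  Cod :: "'m \<Rightarrow> 'o"
  Ident :: "'o \<Rightarrow> 'm"
  Comp :: "'m \<Rightarrow> 'm \<Rightarrow> 'm"

definition Hom :: "('o, 'm) cat \<Rightarrow> 'o \<Rightarrow> 'o \<Rightarrow> 'm set" where
  "Hom K x y = {f \<in> Arr K. Dom K f = x \<and> Cod K f = y}"

locale category =
  fixes K :: "('o, 'm) cat"
  assumes Dom_Obj: "f \<in> Arr K \<Longrightarrow> Dom K f \<in> Obj K"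
    and Cod_Obj: "f \<in> Arr K \<Longrightarrow> Cod K f \<in> Obj K"
    and Ident_Hom: "x \<in> Obj K \<Longrightarrow> Ident K x \<in> Hom K x x"
    and Comp_Hom: "f \<in> Hom K x y \<Longrightarrow> g \<in> Hom K y z \<Longrightarrow> Comp K g f \<in> Hom K x z"
    and Comp_Ident_left: "f \<in> Hom K x y \<Longrightarrow> Comp K (Ident K y) f = f"
    and Comp_Ident_right: "f \<in> Hom K x y \<Longrightarrow> Comp K f (Ident K x) = f"
    and Comp_assoc: "f \<in> Hom K w x \<Longrightarrow> g \<in> Hom K x y \<Longrightarrow> h \<in> Hom K y z
      \<Longrightarrow> Comp K h (Comp K g f) = Comp K (Comp K h g) f"

definition is_iso :: "('o, 'm) cat \<Rightarrow> 'm \<Rightarrow> bool" where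
  "is_iso K f \<longleftrightarrow> f \<in> Arr K \<and>
     (\<exists>g \<in> Hom K (Cod K f) (Dom K f).
        Comp K g f = Ident K (Dom K f) \<and> Comp K f g = Ident K (Cod K f))"

record ('o, 'm, 'p, 'n) fctr =
  OMap :: "'o \<Rightarrow> 'p"
  AMap :: "'m \<Rightarrow> 'n"

locale functor_between =
  source: category K + target: category L
  for K :: "('o, 'm) cat" and L :: "('p, 'n) cat" +
  fixes \<Phi> :: "('o, 'm, 'p, 'n) fctr"
  assumes OMap_Obj: "x \<in> Obj K \<Longrightarrow> OMap \<Phi> x \<in> Obj L"
    and AMap_Hom: "f \<in> Hom K x y \<Longrightarrow> AMap \<Phi> f \<in> Hom L (OMap \<Phi> x) (OMap \<Phi> y)"
    and AMap_Ident: "x \<in> Obj K \<Longrightarrow> AMap \<Phi> (Ident K x) = Ident L (OMap \<Phi> x)"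
    and AMap_Comp: "f \<in> Hom K x y \<Longrightarrow> g \<in> Hom K y z
      \<Longrightarrow> AMap \<Phi> (Comp K g f) = Comp L (AMap \<Phi> g) (AMap \<Phi> f)"

definition id_functor :: "('o, 'm, 'o, 'm) fctr" where
  "id_functor = \<lparr>OMap = (\<lambda>x. x), AMap = (\<lambda>f. f)\<rparr>"

definition comp_functor ::
  "('p, 'n, 'q, 'k) fctr \<Rightarrow> ('o, 'm, 'p, 'n) fctr \<Rightarrow> ('o, 'm, 'q, 'k) fctr" where
  "comp_functor \<Psi> \<Phi> = \<lparr>OMap = OMap \<Psi> \<circ> OMap \<Phi>, AMap = AMap \<Psi> \<circ> AMap \<Phi>\<rparr>"

definition natural_iso ::
  "('o, 'm) cat \<Rightarrow> ('p, 'n) cat \<Rightarrow> ('o, 'm, 'p, 'n) fctr \<Rightarrow> ('o, 'm, 'p, 'n) fctr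
     \<Rightarrow> ('o \<Rightarrow> 'n) \<Rightarrow> bool" where
  "natural_iso K L \<Phi> \<Psi> \<eta> \<longleftrightarrow>
     (\<forall>x \<in> Obj K. \<eta> x \<in> Hom L (OMap \<Phi> x) (OMap \<Psi> x) \<and> is_iso L (\<eta> x)) \<and>
     (\<forall>f \<in> Arr K. Comp L (\<eta> (Cod K f)) (AMap \<Phi> f) = Comp L (AMap \<Psi> f) (\<eta> (Dom K f)))"

definition is_equivalence ::
  "('o, 'm) cat \<Rightarrow> ('p, 'n) cat \<Rightarrow> ('o, 'm, 'p, 'n) fctr \<Rightarrow> bool" where
  "is_equivalence K L \<Phi> \<longleftrightarrow> functor_between K L \<Phi> \<and>
     (\<exists>\<Psi> \<eta> \<epsilon>. functor_between L K \<Psi> \<and>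
        natural_iso K K id_functor (comp_functor \<Psi> \<Phi>) \<eta> \<and>
        natural_iso L L (comp_functor \<Phi> \<Psi>) id_functor \<epsilon>)"


section \<open>Limits and colimits\<close>

definition is_initial :: "('o, 'm) cat \<Rightarrow> 'o \<Rightarrow> bool" where
  "is_initial K i \<longleftrightarrow> i \<in> Obj K \<and> (\<forall>x \<in> Obj K. \<exists>!f. f \<in> Hom K i x)"

definition is_terminal :: "('o, 'm) cat \<Rightarrow> 'o \<Rightarrow> bool" where
  "is_terminal K t \<longleftrightarrow> t \<in> Obj K \<and> (\<forall>x \<in> Obj K. \<exists>!f. f \<in> Hom K x t)"

definition is_cone ::
  "('i, 'j) cat \<Rightarrow> ('o, 'm) cat \<Rightarrow> ('i, 'j, 'o, 'm) fctr \<Rightarrow> 'o \<Rightarrow> ('i \<Rightarrow> 'm) \<Rightarrow> bool" where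
  "is_cone J K D l \<pi> \<longleftrightarrow> l \<in> Obj K \<and> (\<forall>i \<in> Obj J. \<pi> i \<in> Hom K l (OMap D i)) \<and>
     (\<forall>u \<in> Arr J. Comp K (AMap D u) (\<pi> (Dom J u)) = \<pi> (Cod J u))"

definition is_limit ::
  "('i, 'j) cat \<Rightarrow> ('o, 'm) cat \<Rightarrow> ('i, 'j, 'o, 'm) fctr \<Rightarrow> 'o \<Rightarrow> ('i \<Rightarrow> 'm) \<Rightarrow> bool" where
  "is_limit J K D l \<pi> \<longleftrightarrow> is_cone J K D l \<pi> \<and>
     (\<forall>k \<rho>. is_cone J K D k \<rho> \<longrightarrow>
        (\<exists>!h. h \<in> Hom K k l \<and> (\<forall>i \<in> Obj J. Comp K (\<pi> i) h = \<rho> i)))"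

definition is_cocone ::
  "('i, 'j) cat \<Rightarrow> ('o, 'm) cat \<Rightarrow> ('i, 'j, 'o, 'm) fctr \<Rightarrow> 'o \<Rightarrow> ('i \<Rightarrow> 'm) \<Rightarrow> bool" where
  "is_cocone J K D l \<iota> \<longleftrightarrow> l \<in> Obj K \<and> (\<forall>i \<in> Obj J. \<iota> i \<in> Hom K (OMap D i) l) \<and>
     (\<forall>u \<in> Arr J. Comp K (\<iota> (Cod J u)) (AMap D u) = \<iota> (Dom J u))"

definition is_colimit ::
  "('i, 'j) cat \<Rightarrow> ('o, 'm) cat \<Rightarrow> ('i, 'j, 'o, 'm) fctr \<Rightarrow> 'o \<Rightarrow> ('i \<Rightarrow> 'm) \<Rightarrow> bool" where
  "is_colimit J K D l \<iota> \<longleftrightarrow> is_cocone J K D l \<iota> \<and>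
     (\<forall>k \<rho>. is_cocone J K D k \<rho> \<longrightarrow>
        (\<exists>!h. h \<in> Hom K l k \<and> (\<forall>i \<in> Obj J. Comp K h (\<iota> i) = \<rho> i)))"

definition has_limits_of_shape :: "('i, 'j) cat \<Rightarrow> ('o, 'm) cat \<Rightarrow> bool" where
  "has_limits_of_shape J K \<longleftrightarrow> (\<forall>D. functor_between J K D \<longrightarrow> (\<exists>l \<pi>. is_limit J K D l \<pi>))"

definition has_colimits_of_shape :: "('i, 'j) cat \<Rightarrow> ('o, 'm) cat \<Rightarrow> bool" where
  "has_colimits_of_shape J K \<longleftrightarrow> (\<forall>D. functor_between J K D \<longrightarrow> (\<exists>l \<iota>. is_colimit J K D l \<iota>))"


section \<open>Model structures\<close>

text \<open>\<open>lifts K f g\<close>: every commutative square from \<open>f\<close> (on the left) to \<open>g\<close> (on the right)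
  has a diagonal filler.\<close>

definition lifts :: "('o, 'm) cat \<Rightarrow> 'm \<Rightarrow> 'm \<Rightarrow> bool" where
  "lifts K f g \<longleftrightarrow>
     (\<forall>u \<in> Hom K (Dom K f) (Dom K g). \<forall>v \<in> Hom K (Cod K f) (Cod K g).
        Comp K g u = Comp K v f \<longrightarrow>
        (\<exists>h \<in> Hom K (Cod K f) (Dom K g). Comp K h f = u \<and> Comp K g h = v))"

definition llp :: "('o, 'm) cat \<Rightarrow> 'm set \<Rightarrow> 'm set" where
  "llp K R = {f \<in> Arr K. \<forall>g \<in> R. lifts K f g}"

definition rlp :: "('o, 'm) cat \<Rightarrow> 'm set \<Rightarrow> 'm set" where
  "rlp K L = {g \<in> Arr K. \<forall>f \<in> L. lifts K f g}"

definition weak_factorization_system :: "('o, 'm) cat \<Rightarrow> 'm set \<Rightarrow> 'm set \<Rightarrow> bool" where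
  "weak_factorization_system K L R \<longleftrightarrow>
     (\<forall>f \<in> Arr K. \<exists>l \<in> L. \<exists>r \<in> R. Cod K l = Dom K r \<and> f = Comp K r l) \<and>
     L = llp K R \<and> R = rlp K L"

definition retract_of :: "('o, 'm) cat \<Rightarrow> 'm \<Rightarrow> 'm \<Rightarrow> bool" where
  "retract_of K f g \<longleftrightarrow> f \<in> Arr K \<and> g \<in> Arr K \<and>
     (\<exists>i \<in> Hom K (Dom K f) (Dom K g). \<exists>p \<in> Hom K (Dom K g) (Dom K f).
      \<exists>j \<in> Hom K (Cod K f) (Cod K g). \<exists>q \<in> Hom K (Cod K g) (Cod K f).
        Comp K p i = Ident K (Dom K f) \<and> Comp K q j = Ident K (Cod K f) \<and>
        Comp K g i = Comp K j f \<and> Comp K f p = Comp K q g)"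

definition retract_closed :: "('o, 'm) cat \<Rightarrow> 'm set \<Rightarrow> bool" where
  "retract_closed K S \<longleftrightarrow> (\<forall>f g. g \<in> S \<and> retract_of K f g \<longrightarrow> f \<in> S)"

definition wide_subcategory :: "('o, 'm) cat \<Rightarrow> 'm set \<Rightarrow> bool" where
  "wide_subcategory K S \<longleftrightarrow> S \<subseteq> Arr K \<and> (\<forall>x \<in> Obj K. Ident K x \<in> S) \<and>
     (\<forall>f \<in> S. \<forall>g \<in> S. Cod K f = Dom K g \<longrightarrow> Comp K g f \<in> S)"

definition two_out_of_three :: "('o, 'm) cat \<Rightarrow> 'm set \<Rightarrow> bool" where
  "two_out_of_three K W \<longleftrightarrow>
     (\<forall>f \<in> Arr K. \<forall>g \<in> Arr K. Cod K f = Dom K g \<longrightarrow>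
        (f \<in> W \<and> g \<in> W \<longrightarrow> Comp K g f \<in> W) \<and>
        (f \<in> W \<and> Comp K g f \<in> W \<longrightarrow> g \<in> W) \<and>
        (g \<in> W \<and> Comp K g f \<in> W \<longrightarrow> f \<in> W))"

definition model_structure :: "('o, 'm) cat \<Rightarrow> 'm set \<Rightarrow> 'm set \<Rightarrow> 'm set \<Rightarrow> bool" where
  "model_structure K cof we fib \<longleftrightarrow>
     (\<forall>S \<in> {cof, we, fib}. wide_subcategory K S \<and> retract_closed K S) \<and>
     weak_factorization_system K (cof \<inter> we) fib \<and>
     weak_factorization_system K cof (we \<inter> fib) \<and>
     two_out_of_three K we"

definition fibrant_objects :: "('o, 'm) cat \<Rightarrow> 'm set \<Rightarrow> 'o set" where
  "fibrant_objects K fib = {x \<in> Obj K. \<exists>t. is_terminal K t \<and> (\<exists>f \<in> Hom K x t. f \<in> fib)}"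

definition cofibrant_objects :: "('o, 'm) cat \<Rightarrow> 'm set \<Rightarrow> 'o set" where
  "cofibrant_objects K cof = {x \<in> Obj K. \<exists>i. is_initial K i \<and> (\<exists>f \<in> Hom K i x. f \<in> cof)}"


section \<open>Localization\<close>

text \<open>
  The localization of \<open>K\<close> at \<open>W\<close>, by the Gabriel--Zisman construction: arrows are zigzags of
  arrows of \<open>K\<close> and formal inverses of arrows in \<open>W\<close>, modulo the congruence generated by
  the evident relations. A zigzag is written in the order in which it is traversed.
  The universal property, for target categories of arbitrary types, is given by the lemmas
  \<open>localization_inverts\<close>, \<open>localization_extension\<close> and \<open>localization_extension_unique\<close>.
\<close>

datatype 'm step = Fwd 'm | Bwd 'm

inductive zigzag :: "('o, 'm) cat \<Rightarrow> 'm set \<Rightarrow> 'o \<Rightarrow> 'm step list \<Rightarrow> 'o \<Rightarrow> bool"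
  for K W where
  zigzag_Nil: "x \<in> Obj K \<Longrightarrow> zigzag K W x [] x"
| zigzag_Fwd: "f \<in> Hom K x y \<Longrightarrow> zigzag K W y s z \<Longrightarrow> zigzag K W x (Fwd f # s) z"
| zigzag_Bwd: "w \<in> W \<Longrightarrow> w \<in> Hom K y x \<Longrightarrow> zigzag K W y s z \<Longrightarrow> zigzag K W x (Bwd w # s) z"

inductive zigzag_reduces :: "('o, 'm) cat \<Rightarrow> 'm set \<Rightarrow> 'm step list \<Rightarrow> 'm step list \<Rightarrow> bool"
  for K W where
  "x \<in> Obj K \<Longrightarrow> zigzag_reduces K W [Fwd (Ident K x)] []"
| "f \<in> Hom K x y \<Longrightarrow> g \<in> Hom K y z \<Longrightarrow> zigzag_reduces K W [Fwd f, Fwd g] [Fwd (Comp K g f)]"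
| "w \<in> W \<Longrightarrow> zigzag_reduces K W [Fwd w, Bwd w] []"
| "w \<in> W \<Longrightarrow> zigzag_reduces K W [Bwd w, Fwd w] []"

inductive zigzag_equiv ::
  "('o, 'm) cat \<Rightarrow> 'm set \<Rightarrow> 'o \<Rightarrow> 'o \<Rightarrow> 'm step list \<Rightarrow> 'm step list \<Rightarrow> bool"
  for K W x y where
  zigzag_equiv_refl: "zigzag K W x s y \<Longrightarrow> zigzag_equiv K W x y s s"
| zigzag_equiv_sym: "zigzag_equiv K W x y s t \<Longrightarrow> zigzag_equiv K W x y t s"
| zigzag_equiv_trans: "zigzag_equiv K W x y s t \<Longrightarrow> zigzag_equiv K W x y t u
    \<Longrightarrow> zigzag_equiv K W x y s u"
| zigzag_equiv_step: "zigzag_reduces K W a b \<Longrightarrow> zigzag K W x (s @ a @ t) y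
    \<Longrightarrow> zigzag K W x (s @ b @ t) y \<Longrightarrow> zigzag_equiv K W x y (s @ a @ t) (s @ b @ t)"

definition zigzag_class ::
  "('o, 'm) cat \<Rightarrow> 'm set \<Rightarrow> 'o \<Rightarrow> 'o \<Rightarrow> 'm step list \<Rightarrow> 'm step list set" where
  "zigzag_class K W x y s = {t. zigzag_equiv K W x y s t}"

definition localization ::
  "('o, 'm) cat \<Rightarrow> 'm set \<Rightarrow> ('o, 'o \<times> 'm step list set \<times> 'o) cat" where
  "localization K W = \<lparr>
     Obj = Obj K,
     Arr = {(x, zigzag_class K W x y s, y) | x y s. zigzag K W x s y},
     Dom = (\<lambda>(x, _, _). x),
     Cod = (\<lambda>(_, _, y). y),
     Ident = (\<lambda>x. (x, zigzag_class K W x x [], x)),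
     Comp = (\<lambda>(_, T, z) (x, S, _).
       (x, \<Union>s\<in>S. \<Union>t\<in>T. zigzag_class K W x z (s @ t), z))\<rparr>"

definition localization_functor ::
  "('o, 'm) cat \<Rightarrow> 'm set \<Rightarrow> ('o, 'm, 'o, 'o \<times> 'm step list set \<times> 'o) fctr" where
  "localization_functor K W = \<lparr>
     OMap = (\<lambda>x. x),
     AMap = (\<lambda>f. (Dom K f, zigzag_class K W (Dom K f) (Cod K f) [Fwd f], Cod K f))\<rparr>"


section \<open>Preorders as categories\<close>

definition preorder_cat :: "'a set \<Rightarrow> 'a rel \<Rightarrow> ('a, 'a \<times> 'a) cat" where
  "preorder_cat A r = \<lparr>Obj = A, Arr = r, Dom = fst, Cod = snd,
     Ident = (\<lambda>x. (x, x)), Comp = (\<lambda>g f. (fst f, snd g))\<rparr>"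

definition inclusion_functor :: "('a, 'a \<times> 'a, 'a, 'a \<times> 'a) fctr" where
  "inclusion_functor = id_functor"

text \<open>
  A definition cannot quantify over index categories of all types, so "small" is read as
  "with objects of type \<open>'a\<close> and arrows of type \<open>'a \<times> 'a\<close>". Nothing is lost:
  lemmas \<open>bicomplete_has_limits\<close> and \<open>bicomplete_has_colimits\<close> below give all limits and
  colimits indexed by categories of arbitrary types.
\<close>

definition bicomplete :: "'a set \<Rightarrow> 'a rel \<Rightarrow> bool" where
  "bicomplete A r \<longleftrightarrow>
     (\<forall>J :: ('a, 'a \<times> 'a) cat. category J \<longrightarrow>
        has_limits_of_shape J (preorder_cat A r) \<and> has_colimits_of_shape J (preorder_cat A r))"

definition isomorphic_in :: "'a rel \<Rightarrow> 'a \<Rightarrow> 'a \<Rightarrow> bool" where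
  "isomorphic_in r x y \<longleftrightarrow> (x, y) \<in> r \<and> (y, x) \<in> r"

definition iso_closed :: "'a set \<Rightarrow> 'a rel \<Rightarrow> 'a set \<Rightarrow> bool" where
  "iso_closed A r S \<longleftrightarrow> (\<forall>x \<in> S. \<forall>y \<in> A. isomorphic_in r x y \<longrightarrow> y \<in> S)"

definition is_least :: "'a rel \<Rightarrow> 'a set \<Rightarrow> 'a \<Rightarrow> bool" where
  "is_least r S m \<longleftrightarrow> m \<in> S \<and> (\<forall>s \<in> S. (m, s) \<in> r)"

definition is_greatest :: "'a rel \<Rightarrow> 'a set \<Rightarrow> 'a \<Rightarrow> bool" where
  "is_greatest r S m \<longleftrightarrow> m \<in> S \<and> (\<forall>s \<in> S. (s, m) \<in> r)"

text \<open>Minimality and maximality are up to isomorphism: an element below a minimal one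
  is isomorphic, not necessarily equal, to it.\<close>

definition is_minimal :: "'a rel \<Rightarrow> 'a set \<Rightarrow> 'a \<Rightarrow> bool" where
  "is_minimal r S m \<longleftrightarrow> m \<in> S \<and> (\<forall>s \<in> S. (s, m) \<in> r \<longrightarrow> isomorphic_in r s m)"

definition is_maximal :: "'a rel \<Rightarrow> 'a set \<Rightarrow> 'a \<Rightarrow> bool" where
  "is_maximal r S m \<longleftrightarrow> m \<in> S \<and> (\<forall>s \<in> S. (m, s) \<in> r \<longrightarrow> isomorphic_in r s m)"

definition upper_bounds_in :: "'a rel \<Rightarrow> 'a set \<Rightarrow> 'a \<Rightarrow> 'a set" where
  "upper_bounds_in r S x = {y \<in> S. (x, y) \<in> r}"

definition lower_bounds_in :: "'a rel \<Rightarrow> 'a set \<Rightarrow> 'a \<Rightarrow> 'a set" where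
  "lower_bounds_in r S x = {y \<in> S. (y, x) \<in> r}"

definition reflective :: "'a set \<Rightarrow> 'a rel \<Rightarrow> 'a set \<Rightarrow> bool" where
  "reflective A r F \<longleftrightarrow> (\<forall>x \<in> A. \<exists>y. is_least r (upper_bounds_in r F x) y)"

definition coreflective :: "'a set \<Rightarrow> 'a rel \<Rightarrow> 'a set \<Rightarrow> bool" where
  "coreflective A r C \<longleftrightarrow> (\<forall>x \<in> A. \<exists>y. is_greatest r (lower_bounds_in r C x) y)"

lemma category_preorder_cat:
  assumes "preorder_on A r"
  shows "category (preorder_cat A r)"
  using assms
  by unfold_locales (auto simp: preorder_cat_def Hom_def preorder_on_def refl_on_def dest: transD)

lemma Hom_preorder_cat:
  "Hom (preorder_cat A r) x y = (if (x, y) \<in> r then {(x, y)} else {})"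
  by (auto simp: Hom_def preorder_cat_def)

lemma Comp_preorder_cat: "Comp (preorder_cat A r) g f = (fst f, snd g)"
  by (simp add: preorder_cat_def)

lemma preorder_limit_of_glb:
  assumes A: "preorder_on A r" and D: "functor_between J (preorder_cat A r) D"
    and m: "m \<in> A" "\<forall>i \<in> Obj J. (m, OMap D i) \<in> r"
    and greatest: "\<forall>k \<in> A. (\<forall>i \<in> Obj J. (k, OMap D i) \<in> r) \<longrightarrow> (k, m) \<in> r"
  shows "is_limit J (preorder_cat A r) D m (\<lambda>i. (m, OMap D i))"
proof -
  interpret D: functor_between J "preorder_cat A r" D by fact
  have "is_cone J (preorder_cat A r) D m (\<lambda>i. (m, OMap D i))"
    unfolding is_cone_def
  proof (intro conjI ballI)
    fix u assume u: "u \<in> Arr J"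
    then have "AMap D u \<in> Hom (preorder_cat A r) (OMap D (Dom J u)) (OMap D (Cod J u))"
      by (intro D.AMap_Hom) (simp add: Hom_def)
    then show "Comp (preorder_cat A r) (AMap D u) (m, OMap D (Dom J u)) = (m, OMap D (Cod J u))"
      by (auto simp: preorder_cat_def Hom_def)
  qed (use m in \<open>auto simp: Hom_preorder_cat\<close>, simp add: preorder_cat_def)
  moreover have "\<exists>!h. h \<in> Hom (preorder_cat A r) k m \<and>
      (\<forall>i \<in> Obj J. Comp (preorder_cat A r) (m, OMap D i) h = \<rho> i)"
    if k: "is_cone J (preorder_cat A r) D k \<rho>" for k \<rho>
  proof -
    have *: "\<forall>i \<in> Obj J. (k, OMap D i) \<in> r \<and> \<rho> i = (k, OMap D i)" and "k \<in> A"
      using k by (auto simp: is_cone_def Hom_preorder_cat split: if_splits) (simp add: preorder_cat_def)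
    then have "(k, m) \<in> r" using greatest by blast
    then show ?thesis using * by (auto simp: Hom_preorder_cat Comp_preorder_cat)
  qed
  ultimately show ?thesis by (auto simp: is_limit_def)
qed

lemma preorder_colimit_of_lub:
  assumes A: "preorder_on A r" and D: "functor_between J (preorder_cat A r) D"
    and m: "m \<in> A" "\<forall>i \<in> Obj J. (OMap D i, m) \<in> r"
    and least: "\<forall>k \<in> A. (\<forall>i \<in> Obj J. (OMap D i, k) \<in> r) \<longrightarrow> (m, k) \<in> r"
  shows "is_colimit J (preorder_cat A r) D m (\<lambda>i. (OMap D i, m))"
proof -
  interpret D: functor_between J "preorder_cat A r" D by fact
  have "is_cocone J (preorder_cat A r) D m (\<lambda>i. (OMap D i, m))"
    unfolding is_cocone_def
  proof (intro conjI ballI)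
    fix u assume u: "u \<in> Arr J"
    then have "AMap D u \<in> Hom (preorder_cat A r) (OMap D (Dom J u)) (OMap D (Cod J u))"
      by (intro D.AMap_Hom) (simp add: Hom_def)
    then show "Comp (preorder_cat A r) (OMap D (Cod J u), m) (AMap D u) = (OMap D (Dom J u), m)"
      by (auto simp: preorder_cat_def Hom_def)
  qed (use m in \<open>auto simp: Hom_preorder_cat\<close>, simp add: preorder_cat_def)
  moreover have "\<exists>!h. h \<in> Hom (preorder_cat A r) m k \<and>
      (\<forall>i \<in> Obj J. Comp (preorder_cat A r) h (OMap D i, m) = \<rho> i)"
    if k: "is_cocone J (preorder_cat A r) D k \<rho>" for k \<rho>
  proof -
    have *: "\<forall>i \<in> Obj J. (OMap D i, k) \<in> r \<and> \<rho> i = (OMap D i, k)" and "k \<in> A"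
      using k by (auto simp: is_cocone_def Hom_preorder_cat split: if_splits) (simp add: preorder_cat_def)
    then have "(m, k) \<in> r" using least by blast
    then show ?thesis using * by (auto simp: Hom_preorder_cat Comp_preorder_cat)
  qed
  ultimately show ?thesis by (auto simp: is_colimit_def)
qed

lemma bicomplete_iff:
  assumes A: "preorder_on A r"
  shows "bicomplete A r \<longleftrightarrow>
    (\<forall>S. S \<subseteq> A \<longrightarrow> (\<exists>m. is_greatest r {k \<in> A. \<forall>s \<in> S. (k, s) \<in> r} m) \<and>
      (\<exists>m. is_least r {k \<in> A. \<forall>s \<in> S. (s, k) \<in> r} m))"
proof (intro iffI allI impI)
  fix S assume bicomplete: "bicomplete A r" and S: "S \<subseteq> A"
  define J where "J = preorder_cat S {(x, x) | x. x \<in> S}"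
  define D :: "('a, 'a \<times> 'a, 'a, 'a \<times> 'a) fctr" where "D = id_functor"
  have J: "category J"
    by unfold_locales (auto simp: J_def preorder_cat_def Hom_def)
  have D: "functor_between J (preorder_cat A r) D"
  proof -
    interpret J: category J by (rule J)
    interpret A: category "preorder_cat A r" using A by (rule category_preorder_cat)
    show ?thesis
      by unfold_locales
        (use S A in \<open>auto simp: J_def D_def id_functor_def preorder_cat_def Hom_def preorder_on_def refl_on_def\<close>)
  qed
  from bicomplete J D obtain l \<pi> l' \<iota>
    where lim: "is_limit J (preorder_cat A r) D l \<pi>"
      and colim: "is_colimit J (preorder_cat A r) D l' \<iota>"
    unfolding bicomplete_def has_limits_of_shape_def has_colimits_of_shape_def by meson
  have *: "Obj J = S" "\<And>x. OMap D x = x" "\<And>u. AMap D u = u" "Arr J = {(x, x) | x. x \<in> S}"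
    "Dom J = fst" "Cod J = snd"
    by (auto simp: J_def D_def preorder_cat_def id_functor_def)
  have cone: "is_cone J (preorder_cat A r) D k (\<lambda>i. (k, i))"
    if "k \<in> A" "\<forall>s \<in> S. (k, s) \<in> r" for k
    using that by (auto simp: is_cone_def * Hom_preorder_cat) (auto simp: preorder_cat_def)
  have cocone: "is_cocone J (preorder_cat A r) D k (\<lambda>i. (i, k))"
    if "k \<in> A" "\<forall>s \<in> S. (s, k) \<in> r" for k
    using that by (auto simp: is_cocone_def * Hom_preorder_cat) (auto simp: preorder_cat_def)
  have "is_greatest r {k \<in> A. \<forall>s \<in> S. (k, s) \<in> r} l"
    unfolding is_greatest_def
  proof (intro conjI ballI)
    show "l \<in> {k \<in> A. \<forall>s \<in> S. (k, s) \<in> r}"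
      using lim by (auto simp: is_limit_def is_cone_def * Hom_def) (auto simp: preorder_cat_def)
    fix k assume "k \<in> {k \<in> A. \<forall>s \<in> S. (k, s) \<in> r}"
    then have "\<exists>h. h \<in> Hom (preorder_cat A r) k l"
      using lim cone unfolding is_limit_def by blast
    then show "(k, l) \<in> r" by (auto simp: Hom_preorder_cat split: if_splits)
  qed
  moreover have "is_least r {k \<in> A. \<forall>s \<in> S. (s, k) \<in> r} l'"
    unfolding is_least_def
  proof (intro conjI ballI)
    show "l' \<in> {k \<in> A. \<forall>s \<in> S. (s, k) \<in> r}"
      using colim by (auto simp: is_colimit_def is_cocone_def * Hom_def) (auto simp: preorder_cat_def)
    fix k assume "k \<in> {k \<in> A. \<forall>s \<in> S. (s, k) \<in> r}"
    then have "\<exists>h. h \<in> Hom (preorder_cat A r) l' k"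
      using colim cocone unfolding is_colimit_def by blast
    then show "(l', k) \<in> r" by (auto simp: Hom_preorder_cat split: if_splits)
  qed
  ultimately show "(\<exists>m. is_greatest r {k \<in> A. \<forall>s \<in> S. (k, s) \<in> r} m) \<and>
    (\<exists>m. is_least r {k \<in> A. \<forall>s \<in> S. (s, k) \<in> r} m)" by blast
next
  assume *: "\<forall>S. S \<subseteq> A \<longrightarrow> (\<exists>m. is_greatest r {k \<in> A. \<forall>s \<in> S. (k, s) \<in> r} m) \<and>
      (\<exists>m. is_least r {k \<in> A. \<forall>s \<in> S. (s, k) \<in> r} m)"
  have "has_limits_of_shape J (preorder_cat A r) \<and> has_colimits_of_shape J (preorder_cat A r)"
    for J :: "('a, 'a \<times> 'a) cat"
    unfolding has_limits_of_shape_def has_colimits_of_shape_def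
  proof (intro conjI allI impI)
    fix D assume D: "functor_between J (preorder_cat A r) D"
    then have "OMap D ` Obj J \<subseteq> A"
      using functor_between.OMap_Obj[OF D] by (auto simp: preorder_cat_def)
    with * obtain m m' where
      "is_greatest r {k \<in> A. \<forall>s \<in> OMap D ` Obj J. (k, s) \<in> r} m"
      "is_least r {k \<in> A. \<forall>s \<in> OMap D ` Obj J. (s, k) \<in> r} m'" by meson
    with preorder_limit_of_glb[OF A D, of m] preorder_colimit_of_lub[OF A D, of m']
    show "\<exists>l \<pi>. is_limit J (preorder_cat A r) D l \<pi>" "\<exists>l \<pi>. is_colimit J (preorder_cat A r) D l \<pi>"
      by (auto simp: is_greatest_def is_least_def)
  qed
  then show "bicomplete A r" by (simp add: bicomplete_def)
qed

lemma bicomplete_has_limits: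
  fixes J :: "('i, 'j) cat"
  assumes A: "preorder_on A r" and bicomplete: "bicomplete A r"
  shows "has_limits_of_shape J (preorder_cat A r)"
  unfolding has_limits_of_shape_def
proof (intro allI impI)
  fix D assume D: "functor_between J (preorder_cat A r) D"
  then have "OMap D ` Obj J \<subseteq> A"
    using functor_between.OMap_Obj[OF D] by (auto simp: preorder_cat_def)
  with bicomplete A obtain m where "is_greatest r {k \<in> A. \<forall>s \<in> OMap D ` Obj J. (k, s) \<in> r} m"
    by (auto simp only: bicomplete_iff)
  with preorder_limit_of_glb[OF A D, of m] show "\<exists>l \<pi>. is_limit J (preorder_cat A r) D l \<pi>"
    by (auto simp: is_greatest_def)
qed

lemma bicomplete_has_colimits:
  fixes J :: "('i, 'j) cat"
  assumes A: "preorder_on A r" and bicomplete: "bicomplete A r"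
  shows "has_colimits_of_shape J (preorder_cat A r)"
  unfolding has_colimits_of_shape_def
proof (intro allI impI)
  fix D assume D: "functor_between J (preorder_cat A r) D"
  then have "OMap D ` Obj J \<subseteq> A"
    using functor_between.OMap_Obj[OF D] by (auto simp: preorder_cat_def)
  with bicomplete A obtain m where "is_least r {k \<in> A. \<forall>s \<in> OMap D ` Obj J. (s, k) \<in> r} m"
    by (auto simp only: bicomplete_iff)
  with preorder_colimit_of_lub[OF A D, of m] show "\<exists>l \<pi>. is_colimit J (preorder_cat A r) D l \<pi>"
    by (auto simp: is_least_def)
qed


subsection \<open>Universal property of the localization\<close>

lemma zigzag_append: "zigzag K W x s y \<Longrightarrow> zigzag K W y t z \<Longrightarrow> zigzag K W x (s @ t) z"
  by (induction rule: zigzag.induct) (auto intro: zigzag.intros)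

lemma zigzag_equiv_zigzag:
  "zigzag_equiv K W x y s t \<Longrightarrow> zigzag K W x s y \<and> zigzag K W x t y"
  by (induction rule: zigzag_equiv.induct) auto

lemma zigzag_class_eq_iff:
  assumes "zigzag K W x s y"
  shows "zigzag_class K W x y s = zigzag_class K W x y t \<longleftrightarrow> zigzag_equiv K W x y s t"
  using assms unfolding zigzag_class_def
  by (auto intro: zigzag_equiv.intros)

lemma zigzag_equiv_append_right:
  "zigzag_equiv K W x y s s' \<Longrightarrow> zigzag K W y t z \<Longrightarrow> zigzag_equiv K W x z (s @ t) (s' @ t)"
proof (induction rule: zigzag_equiv.induct)
  case (zigzag_equiv_step a b u v)
  then show ?case
    using zigzag_equiv.zigzag_equiv_step[of K W a b x u "v @ t" z]
      zigzag_append[of K W x "u @ a @ v" y t z] zigzag_append[of K W x "u @ b @ v" y t z] by simp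
qed (auto intro: zigzag_equiv.intros zigzag_append)

lemma zigzag_equiv_append_left:
  "zigzag_equiv K W y z t t' \<Longrightarrow> zigzag K W x s y \<Longrightarrow> zigzag_equiv K W x z (s @ t) (s @ t')"
proof (induction rule: zigzag_equiv.induct)
  case (zigzag_equiv_step a b u v)
  then show ?case
    using zigzag_equiv.zigzag_equiv_step[of K W a b x "s @ u" v z]
      zigzag_append[of K W x s y "u @ a @ v" z] zigzag_append[of K W x s y "u @ b @ v" z] by simp
qed (auto intro: zigzag_equiv.intros zigzag_append)

lemma zigzag_equiv_append:
  assumes "zigzag_equiv K W x y s s'" "zigzag_equiv K W y z t t'"
  shows "zigzag_equiv K W x z (s @ t) (s' @ t')"
  using assms zigzag_equiv_append_left[of K W y z t t' x s']
    zigzag_equiv_append_right[of K W x y s s' t z]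
  by (meson zigzag_equiv_zigzag zigzag_equiv.zigzag_equiv_trans)

lemma localization_Comp:
  assumes "zigzag K W x s y" "zigzag K W y t z"
  shows "Comp (localization K W) (y, zigzag_class K W y z t, z) (x, zigzag_class K W x y s, y)
    = (x, zigzag_class K W x z (s @ t), z)"
proof -
  have "zigzag_class K W x z (s' @ t') = zigzag_class K W x z (s @ t)"
    if "s' \<in> zigzag_class K W x y s" "t' \<in> zigzag_class K W y z t" for s' t'
    using that zigzag_equiv_append[of K W x y s s' z t t'] assms
    by (metis mem_Collect_eq zigzag_append zigzag_class_def zigzag_class_eq_iff)
  moreover have "s \<in> zigzag_class K W x y s" "t \<in> zigzag_class K W y z t"
    using assms by (auto simp: zigzag_class_def intro: zigzag_equiv.intros)
  ultimately have "(\<Union>s'\<in>zigzag_class K W x y s. \<Union>t'\<in>zigzag_class K W y z t.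
      zigzag_class K W x z (s' @ t')) = zigzag_class K W x z (s @ t)" by blast
  then show ?thesis by (simp add: localization_def)
qed

lemma Hom_localization:
  "Hom (localization K W) x y = {(x, zigzag_class K W x y s, y) | s. zigzag K W x s y}"
  by (auto simp: Hom_def localization_def)

context category
begin

lemma zigzag_Obj: "zigzag K W x s y \<Longrightarrow> x \<in> Obj K \<and> y \<in> Obj K"
  by (induction rule: zigzag.induct) (auto simp: Hom_def dest: Dom_Obj Cod_Obj)

lemma zigzag_single:
  assumes "f \<in> Hom K x y"
  shows "zigzag K W x [Fwd f] y"
  using assms Cod_Obj by (auto intro!: zigzag.intros simp: Hom_def)

lemma zigzag_single_inverse:
  assumes "w \<in> Hom K y x" "w \<in> W"
  shows "zigzag K W x [Bwd w] y"
  using assms Dom_Obj by (auto intro!: zigzag.intros simp: Hom_def)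

lemma category_localization: "category (localization K W)"
proof
  show "Dom (localization K W) f \<in> Obj (localization K W)"
    "Cod (localization K W) f \<in> Obj (localization K W)" if "f \<in> Arr (localization K W)" for f
    using that by (auto simp: localization_def dest: zigzag_Obj)
  have id: "Ident (localization K W) x = (x, zigzag_class K W x x [], x)" for x
    by (simp add: localization_def)
  show "Ident (localization K W) x \<in> Hom (localization K W) x x"
    if "x \<in> Obj (localization K W)" for x
    using that unfolding Hom_localization id by (auto simp: localization_def intro: zigzag.intros)
  show "Comp (localization K W) g f \<in> Hom (localization K W) x z"
    if "f \<in> Hom (localization K W) x y" "g \<in> Hom (localization K W) y z" for f g x y z
    using that by (auto simp: Hom_localization localization_Comp intro: zigzag_append)
  show "Comp (localization K W) (Ident (localization K W) y) f = f"
    "Comp (localization K W) f (Ident (localization K W) x) = f"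
    if "f \<in> Hom (localization K W) x y" for f x y
    using that zigzag_Obj
    by (fastforce simp: Hom_localization id localization_Comp zigzag_Nil)+
  show "Comp (localization K W) h (Comp (localization K W) g f)
      = Comp (localization K W) (Comp (localization K W) h g) f"
    if "f \<in> Hom (localization K W) w x" "g \<in> Hom (localization K W) x y"
      "h \<in> Hom (localization K W) y z" for f g h w x y z
    using that by (auto simp: Hom_localization localization_Comp zigzag_append)
qed

lemma AMap_localization_functor:
  "f \<in> Hom K x y \<Longrightarrow>
    AMap (localization_functor K W) f = (x, zigzag_class K W x y [Fwd f], y)"
  by (simp add: localization_functor_def Hom_def)

lemma zigzag_class_reduces:
  assumes "zigzag_reduces K W a b" "zigzag K W x a y" "zigzag K W x b y"
  shows "zigzag_class K W x y a = zigzag_class K W x y b"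
  using assms zigzag_equiv_step[of K W a b x "[]" "[]" y] by (simp add: zigzag_class_eq_iff)

lemma functor_localization:
  "functor_between K (localization K W) (localization_functor K W)"
proof -
  interpret loc: category "localization K W" by (rule category_localization)
  show ?thesis
  proof
    show "OMap (localization_functor K W) x \<in> Obj (localization K W)" if "x \<in> Obj K" for x
      using that by (simp add: localization_functor_def localization_def)
    show "AMap (localization_functor K W) f \<in> Hom (localization K W)
        (OMap (localization_functor K W) x) (OMap (localization_functor K W) y)"
      if "f \<in> Hom K x y" for f x y
      using that zigzag_single[of f x y W]
      by (auto simp: AMap_localization_functor Hom_localization) (auto simp: localization_functor_def)
    show "AMap (localization_functor K W) (Ident K x)
        = Ident (localization K W) (OMap (localization_functor K W) x)" if x: "x \<in> Obj K" for x
      using zigzag_class_reduces[OF zigzag_reduces.intros(1), OF x zigzag_single[OF Ident_Hom[OF x]] zigzag_Nil[OF x]] x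
      by (simp add: AMap_localization_functor[OF Ident_Hom])
        (simp add: localization_functor_def localization_def)
    show "AMap (localization_functor K W) (Comp K g f) = Comp (localization K W)
        (AMap (localization_functor K W) g) (AMap (localization_functor K W) f)"
      if f: "f \<in> Hom K x y" and g: "g \<in> Hom K y z" for f g x y z
      using zigzag_class_reduces[OF zigzag_reduces.intros(2)[OF f g], of W x z]
        zigzag_append[OF zigzag_single[OF f] zigzag_single[OF g]] zigzag_single[OF Comp_Hom[OF f g]]
      by (simp add: AMap_localization_functor[OF f] AMap_localization_functor[OF g]
          AMap_localization_functor[OF Comp_Hom[OF f g]]
          localization_Comp[OF zigzag_single[OF f] zigzag_single[OF g]])
  qed
qed

lemma localization_inverse:
  assumes w: "w \<in> Hom K y x" "w \<in> W"
  shows "Comp (localization K W) (x, zigzag_class K W x y [Bwd w], y)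
      (AMap (localization_functor K W) w) = Ident (localization K W) y"
    and "Comp (localization K W) (AMap (localization_functor K W) w)
      (x, zigzag_class K W x y [Bwd w], y) = Ident (localization K W) x"
proof -
  note z = zigzag_single[OF w(1), of W] zigzag_single_inverse[OF w]
  note c = zigzag_append[OF z] zigzag_append[OF z(2,1)]
  have o: "x \<in> Obj K" "y \<in> Obj K" using zigzag_Obj z by blast+
  show "Comp (localization K W) (x, zigzag_class K W x y [Bwd w], y)
      (AMap (localization_functor K W) w) = Ident (localization K W) y"
    using zigzag_class_reduces[OF zigzag_reduces.intros(3), OF w(2), where x = y and y = y] c o
    by (simp add: AMap_localization_functor[OF w(1)] localization_Comp[OF z] zigzag_Nil)
      (simp add: localization_def)
  show "Comp (localization K W) (AMap (localization_functor K W) w)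
      (x, zigzag_class K W x y [Bwd w], y) = Ident (localization K W) x"
    using zigzag_class_reduces[OF zigzag_reduces.intros(4), OF w(2), where x = x and y = x] c o
    by (simp add: AMap_localization_functor[OF w(1)] localization_Comp[OF z(2,1)] zigzag_Nil)
      (simp add: localization_def)
qed

lemma localization_inverts:
  assumes "w \<in> W" "w \<in> Arr K"
  shows "is_iso (localization K W) (AMap (localization_functor K W) w)"
proof -
  have w: "w \<in> Hom K (Dom K w) (Cod K w)" using assms by (simp add: Hom_def)
  interpret F: functor_between K "localization K W" "localization_functor K W"
    by (rule functor_localization)
  have h: "AMap (localization_functor K W) w \<in> Hom (localization K W) (Dom K w) (Cod K w)"
    using F.AMap_Hom[OF w] by (simp add: localization_functor_def)
  then have "Dom (localization K W) (AMap (localization_functor K W) w) = Dom K w"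
    "Cod (localization K W) (AMap (localization_functor K W) w) = Cod K w"
    "AMap (localization_functor K W) w \<in> Arr (localization K W)"
    by (simp_all add: Hom_def)
  moreover have "(Cod K w, zigzag_class K W (Cod K w) (Dom K w) [Bwd w], Dom K w)
      \<in> Hom (localization K W) (Cod K w) (Dom K w)"
    using zigzag_single_inverse[OF w \<open>w \<in> W\<close>] by (auto simp: Hom_localization)
  ultimately show ?thesis
    using localization_inverse[OF w \<open>w \<in> W\<close>] unfolding is_iso_def by auto
qed

lemma inverse_unique:
  assumes "f \<in> Hom K x y" "g \<in> Hom K y x" "h \<in> Hom K y x"
    and "Comp K g f = Ident K x" "Comp K f h = Ident K y"
  shows "g = h"
proof -
  have "g = Comp K g (Comp K f h)" using assms by (simp add: Comp_Ident_right)
  also have "\<dots> = Comp K (Comp K g f) h" using assms by (intro Comp_assoc) auto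
  also have "\<dots> = h" using assms by (simp add: Comp_Ident_left)
  finally show ?thesis .
qed

end

definition inverse_arr :: "('o, 'm) cat \<Rightarrow> 'm \<Rightarrow> 'm" where
  "inverse_arr K f = (SOME g. g \<in> Hom K (Cod K f) (Dom K f) \<and>
     Comp K g f = Ident K (Dom K f) \<and> Comp K f g = Ident K (Cod K f))"

lemma inverse_arr:
  assumes "is_iso K f" "f \<in> Hom K x y"
  shows "inverse_arr K f \<in> Hom K y x" "Comp K (inverse_arr K f) f = Ident K x"
    "Comp K f (inverse_arr K f) = Ident K y"
proof -
  have "inverse_arr K f \<in> Hom K (Cod K f) (Dom K f) \<and>
     Comp K (inverse_arr K f) f = Ident K (Dom K f) \<and> Comp K f (inverse_arr K f) = Ident K (Cod K f)"
    unfolding inverse_arr_def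
    by (rule someI_ex) (use assms in \<open>auto simp: is_iso_def\<close>)
  then show "inverse_arr K f \<in> Hom K y x" "Comp K (inverse_arr K f) f = Ident K x"
    "Comp K f (inverse_arr K f) = Ident K y" using assms(2) by (auto simp: Hom_def)
qed

primrec zigzag_map ::
  "('o, 'm) cat \<Rightarrow> ('p, 'n) cat \<Rightarrow> ('o, 'm, 'p, 'n) fctr \<Rightarrow> 'o \<Rightarrow> 'm step list \<Rightarrow> 'n" where
  "zigzag_map K L \<Phi> x [] = Ident L (OMap \<Phi> x)"
| "zigzag_map K L \<Phi> x (a # s) = (case a of
      Fwd f \<Rightarrow> Comp L (zigzag_map K L \<Phi> (Cod K f) s) (AMap \<Phi> f)
    | Bwd w \<Rightarrow> Comp L (zigzag_map K L \<Phi> (Dom K w) s) (inverse_arr L (AMap \<Phi> w)))"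

context functor_between
begin

lemma zigzag_map_Hom:
  assumes "\<forall>w \<in> W. is_iso L (AMap \<Phi> w)" "zigzag K W x s y"
  shows "zigzag_map K L \<Phi> x s \<in> Hom L (OMap \<Phi> x) (OMap \<Phi> y)"
  using assms(2)
proof (induction rule: zigzag.induct)
  case (zigzag_Nil x)
  then show ?case by (simp add: OMap_Obj target.Ident_Hom)
next
  case (zigzag_Fwd f x y s z)
  moreover have "Cod K f = y" using zigzag_Fwd by (simp add: Hom_def)
  ultimately show ?case using AMap_Hom[of f x y] by (auto intro: target.Comp_Hom)
next
  case (zigzag_Bwd w y x s z)
  moreover have "Dom K w = y" using zigzag_Bwd by (simp add: Hom_def)
  moreover have "inverse_arr L (AMap \<Phi> w) \<in> Hom L (OMap \<Phi> x) (OMap \<Phi> y)"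
    using zigzag_Bwd assms(1) AMap_Hom by (auto intro: inverse_arr(1))
  ultimately show ?case by (auto intro: target.Comp_Hom)
qed

lemma zigzag_map_append:
  assumes W: "\<forall>w \<in> W. is_iso L (AMap \<Phi> w)" and "zigzag K W x s y" "zigzag K W y t z"
  shows "zigzag_map K L \<Phi> x (s @ t) = Comp L (zigzag_map K L \<Phi> y t) (zigzag_map K L \<Phi> x s)"
  using assms(2,3)
proof (induction rule: zigzag.induct)
  case (zigzag_Nil x)
  then show ?case
    using target.Comp_Ident_right[OF zigzag_map_Hom[OF W zigzag_Nil(2)]] by simp
next
  case (zigzag_Fwd f x y s u)
  have [simp]: "Cod K f = y" using zigzag_Fwd by (simp add: Hom_def)
  show ?case
    using zigzag_Fwd zigzag_map_Hom[OF W] AMap_Hom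
    by (auto intro!: target.Comp_assoc[symmetric])
next
  case (zigzag_Bwd w y x s u)
  have [simp]: "Dom K w = y" using zigzag_Bwd by (simp add: Hom_def)
  have "inverse_arr L (AMap \<Phi> w) \<in> Hom L (OMap \<Phi> x) (OMap \<Phi> y)"
    using zigzag_Bwd W AMap_Hom by (auto intro: inverse_arr(1))
  then show ?case
    using zigzag_Bwd zigzag_map_Hom[OF W]
    by (auto intro!: target.Comp_assoc[symmetric])
qed

lemma zigzag_map_reduces:
  assumes W: "\<forall>w \<in> W. is_iso L (AMap \<Phi> w)" and "zigzag_reduces K W a b"
    and a: "zigzag K W x a y" and b: "zigzag K W x b y"
  shows "zigzag_map K L \<Phi> x a = zigzag_map K L \<Phi> x b"
  using assms(2)
proof cases
  case (1 u)
  with a have u: "u = x" using source.Ident_Hom[of u] by (auto elim!: zigzag.cases simp: Hom_def)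
  with 1 have "Cod K (Ident K x) = x" using source.Ident_Hom[of x] by (simp add: Hom_def)
  with 1 u OMap_Obj show ?thesis
    using target.Comp_Ident_left[OF target.Ident_Hom[of "OMap \<Phi> x"]] by (simp add: AMap_Ident)
next
  case (2 f u v g w)
  then have "Cod K f = v" "Cod K g = w" "Cod K (Comp K g f) = w"
    using source.Comp_Hom[of f u v g w] by (auto simp: Hom_def)
  moreover have "w \<in> Obj K" using 2 source.Cod_Obj by (auto simp: Hom_def)
  ultimately show ?thesis
    using 2 AMap_Hom[of f u v] AMap_Hom[of g v w] OMap_Obj
    by (simp add: AMap_Comp target.Comp_assoc[OF _ _ target.Ident_Hom])
next
  case (3 w)
  with a have w: "w \<in> Hom K x (Cod K w)" and x: "x \<in> Obj K" and xy: "x = y" "Dom K w = x"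
    using source.zigzag_Obj[OF a]
    by (auto elim!: zigzag.cases simp: Hom_def)
  note w' = inverse_arr[OF _ AMap_Hom[OF w]]
  show ?thesis
    using 3 xy x w' W by (simp add: target.Comp_Ident_left)
next
  case (4 w)
  with a have w: "w \<in> Hom K (Dom K w) x" and x: "x \<in> Obj K" and xy: "x = y" "Cod K w = x"
    using source.zigzag_Obj[OF a]
    by (auto elim!: zigzag.cases simp: Hom_def)
  note w' = inverse_arr[OF _ AMap_Hom[OF w]]
  show ?thesis
    using 4 xy x w' W AMap_Hom[OF w] by (simp add: target.Comp_Ident_left)
qed

end

lemma zigzag_appendD: "zigzag K W x (s @ t) z \<Longrightarrow> \<exists>y. zigzag K W x s y \<and> zigzag K W y t z"
  if "category K"
proof (induction s arbitrary: x)
  case Nil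
  then have "zigzag K W x [] x" using category.zigzag_Obj[OF that Nil] by (auto intro: zigzag.intros)
  with Nil show ?case by auto
next
  case (Cons a s)
  from Cons.prems show ?case
    by (cases rule: zigzag.cases) (use Cons.IH in \<open>fastforce intro: zigzag.intros\<close>)+
qed

lemma zigzag_target_unique: "zigzag K W x s y \<Longrightarrow> zigzag K W x s z \<Longrightarrow> y = z"
proof (induction arbitrary: z rule: zigzag.induct)
  case (zigzag_Nil x)
  then show ?case by (auto elim: zigzag.cases)
next
  case (zigzag_Fwd f x y s u)
  from zigzag_Fwd.prems zigzag_Fwd.hyps zigzag_Fwd.IH show ?case
    by cases (auto simp: Hom_def)
next
  case (zigzag_Bwd w y x s u)
  from zigzag_Bwd.prems zigzag_Bwd.hyps zigzag_Bwd.IH show ?case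
    by cases (auto simp: Hom_def)
qed

lemma zigzag_reduces_zigzag:
  assumes K: "category K" and "zigzag_reduces K W a b" and a: "zigzag K W x a y"
  shows "zigzag K W x b y"
proof -
  interpret category K by (rule K)
  from assms(2) show ?thesis
  proof cases
    case (1 u)
    with a have "u = x" "x = y" using Ident_Hom[of u] by (auto elim!: zigzag.cases simp: Hom_def)
    with 1 show ?thesis by (auto intro: zigzag.intros)
  next
    case (2 f u v g w)
    with a have "u = x" "w = y" by (auto elim!: zigzag.cases simp: Hom_def)
    with 2 Comp_Hom[of f u v g w] zigzag_single show ?thesis by auto
  next
    case (3 w)
    with a have "x = y" by (auto elim!: zigzag.cases simp: Hom_def)
    with 3 zigzag_Obj[OF a] show ?thesis by (auto intro: zigzag.intros)
  next
    case (4 w)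
    with a have "x = y" by (auto elim!: zigzag.cases simp: Hom_def)
    with 4 zigzag_Obj[OF a] show ?thesis by (auto intro: zigzag.intros)
  qed
qed

context functor_between
begin

lemma zigzag_map_equiv:
  assumes W: "\<forall>w \<in> W. is_iso L (AMap \<Phi> w)" and "zigzag_equiv K W x y s t"
  shows "zigzag_map K L \<Phi> x s = zigzag_map K L \<Phi> x t"
  using assms(2)
proof (induction rule: zigzag_equiv.induct)
  case (zigzag_equiv_step a b s t)
  note K = source.category_axioms
  from zigzag_appendD[OF K zigzag_equiv_step(2)] obtain u where
    u: "zigzag K W x s u" "zigzag K W u (a @ t) y" by blast
  from zigzag_appendD[OF K u(2)] obtain v where
    v: "zigzag K W u a v" "zigzag K W v t y" by blast
  from zigzag_appendD[OF K zigzag_equiv_step(3)] obtain u' where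
    u': "zigzag K W x s u'" "zigzag K W u' (b @ t) y" by blast
  have "u' = u" using u(1) u'(1) by (rule zigzag_target_unique[symmetric])
  with zigzag_appendD[OF K u'(2)] obtain v' where
    v': "zigzag K W u b v'" "zigzag K W v' t y" by blast
  have b: "zigzag K W u b v" using zigzag_reduces_zigzag[OF K zigzag_equiv_step(1) v(1)] .
  have "zigzag_map K L \<Phi> u a = zigzag_map K L \<Phi> u b"
    by (rule zigzag_map_reduces[OF W zigzag_equiv_step(1) v(1) b])
  then show ?case
    using zigzag_map_append[OF W u(1)] zigzag_map_append[OF W v(1,2)]
      zigzag_map_append[OF W b v(2)] zigzag_append[OF v] zigzag_append[OF b v(2)] by metis
qed auto

lemma localization_extension:
  assumes W: "\<forall>w \<in> W. is_iso L (AMap \<Phi> w)"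
  shows "\<exists>\<Psi>. functor_between (localization K W) L \<Psi> \<and>
    (\<forall>x \<in> Obj K. OMap (comp_functor \<Psi> (localization_functor K W)) x = OMap \<Phi> x) \<and>
    (\<forall>f \<in> Arr K. AMap (comp_functor \<Psi> (localization_functor K W)) f = AMap \<Phi> f)"
proof -
  define \<Psi> :: "('o, 'o \<times> 'm step list set \<times> 'o, 'p, 'n) fctr" where
    "\<Psi> = \<lparr>OMap = OMap \<Phi>, AMap = (\<lambda>(x, S, _). zigzag_map K L \<Phi> x (SOME s. s \<in> S))\<rparr>"
  have OMap: "OMap \<Psi> x = OMap \<Phi> x" for x by (simp add: \<Psi>_def)
  have AMap: "AMap \<Psi> (x, zigzag_class K W x y s, y) = zigzag_map K L \<Phi> x s"
    if "zigzag K W x s y" for x s y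
  proof -
    have "(SOME t. t \<in> zigzag_class K W x y s) \<in> zigzag_class K W x y s"
      by (rule someI[of "\<lambda>t. t \<in> zigzag_class K W x y s" s])
        (use that in \<open>simp add: zigzag_class_def zigzag_equiv_refl\<close>)
    then have "zigzag_equiv K W x y s (SOME t. t \<in> zigzag_class K W x y s)"
      by (simp add: zigzag_class_def)
    from zigzag_map_equiv[OF W this, symmetric] show ?thesis by (simp add: \<Psi>_def)
  qed
  interpret loc: category "localization K W" by (rule source.category_localization)
  have "functor_between (localization K W) L \<Psi>"
  proof
    show "OMap \<Psi> x \<in> Obj L" if "x \<in> Obj (localization K W)" for x
      using that OMap_Obj by (simp add: OMap localization_def)
    show "AMap \<Psi> f \<in> Hom L (OMap \<Psi> x) (OMap \<Psi> y)" if "f \<in> Hom (localization K W) x y" for f x y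
    proof -
      from that obtain s where f: "f = (x, zigzag_class K W x y s, y)" "zigzag K W x s y"
        by (auto simp: Hom_localization)
      show ?thesis
        unfolding f(1) AMap[OF f(2)] OMap by (rule zigzag_map_Hom[OF W f(2)])
    qed
    show "AMap \<Psi> (Ident (localization K W) x) = Ident L (OMap \<Psi> x)"
      if "x \<in> Obj (localization K W)" for x
    proof -
      have "x \<in> Obj K" using that by (simp add: localization_def)
      from AMap[OF zigzag_Nil, OF this] show ?thesis by (simp add: localization_def OMap)
    qed
    show "AMap \<Psi> (Comp (localization K W) g f) = Comp L (AMap \<Psi> g) (AMap \<Psi> f)"
      if "f \<in> Hom (localization K W) x y" "g \<in> Hom (localization K W) y z" for f g x y z
    proof -
      from that obtain s t where
        f: "f = (x, zigzag_class K W x y s, y)" "zigzag K W x s y" and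
        g: "g = (y, zigzag_class K W y z t, z)" "zigzag K W y t z"
        by (auto simp: Hom_localization)
      show ?thesis
        unfolding f(1) g(1) localization_Comp[OF f(2) g(2)] AMap[OF f(2)] AMap[OF g(2)]
          AMap[OF zigzag_append[OF f(2) g(2)]]
        by (rule zigzag_map_append[OF W f(2) g(2)])
    qed
  qed
  moreover have "AMap \<Psi> (AMap (localization_functor K W) f) = AMap \<Phi> f" if "f \<in> Arr K" for f
  proof -
    have f: "f \<in> Hom K (Dom K f) (Cod K f)" using that by (simp add: Hom_def)
    show ?thesis
      unfolding source.AMap_localization_functor[OF f] AMap[OF source.zigzag_single[OF f]]
      using target.Comp_Ident_left[OF AMap_Hom[OF f]] by simp
  qed
  moreover have "OMap \<Psi> (OMap (localization_functor K W) x) = OMap \<Phi> x" for x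
    by (simp add: OMap localization_functor_def)
  ultimately show ?thesis
    by (intro exI[of _ \<Psi>]) (simp add: comp_functor_def)
qed

end

lemma localization_extension_unique:
  assumes K: "category K"
    and \<Psi>: "functor_between (localization K W) L \<Psi>" "functor_between (localization K W) L \<Psi>'"
    and O: "\<forall>x \<in> Obj K. OMap (comp_functor \<Psi> (localization_functor K W)) x
        = OMap (comp_functor \<Psi>' (localization_functor K W)) x"
    and A: "\<forall>f \<in> Arr K. AMap (comp_functor \<Psi> (localization_functor K W)) f
        = AMap (comp_functor \<Psi>' (localization_functor K W)) f"
  shows "\<forall>x \<in> Obj (localization K W). OMap \<Psi> x = OMap \<Psi>' x"
    and "\<forall>f \<in> Arr (localization K W). AMap \<Psi> f = AMap \<Psi>' f"
proof -
  interpret K: category K by (rule K)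
  interpret \<Psi>: functor_between "localization K W" L \<Psi> by fact
  interpret \<Psi>': functor_between "localization K W" L \<Psi>' by fact
  let ?\<gamma> = "localization_functor K W"
  have Obj: "x \<in> Obj (localization K W) \<longleftrightarrow> x \<in> Obj K" for x by (simp add: localization_def)
  have o: "OMap \<Psi> x = OMap \<Psi>' x" if "x \<in> Obj K" for x
    using O that by (simp add: comp_functor_def localization_functor_def)
  have a: "AMap \<Psi> (AMap ?\<gamma> f) = AMap \<Psi>' (AMap ?\<gamma> f)" if "f \<in> Arr K" for f
    using A that by (simp add: comp_functor_def)
  show "\<forall>x \<in> Obj (localization K W). OMap \<Psi> x = OMap \<Psi>' x" by (simp add: o Obj)
  have compose: "AMap \<Psi> (x, zigzag_class K W x z (s @ t), z) = AMap \<Psi>' (x, zigzag_class K W x z (s @ t), z)"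
    if z: "zigzag K W x s y" "zigzag K W y t z"
      and eq: "AMap \<Psi> (x, zigzag_class K W x y s, y) = AMap \<Psi>' (x, zigzag_class K W x y s, y)"
      "AMap \<Psi> (y, zigzag_class K W y z t, z) = AMap \<Psi>' (y, zigzag_class K W y z t, z)" for x y z s t
  proof -
    have "(x, zigzag_class K W x y s, y) \<in> Hom (localization K W) x y"
      "(y, zigzag_class K W y z t, z) \<in> Hom (localization K W) y z"
      using z by (auto simp: Hom_localization)
    from \<Psi>.AMap_Comp[OF this] \<Psi>'.AMap_Comp[OF this] eq show ?thesis
      by (simp add: localization_Comp[OF z])
  qed
  have "AMap \<Psi> (x, zigzag_class K W x y s, y) = AMap \<Psi>' (x, zigzag_class K W x y s, y)"
    if "zigzag K W x s y" for x s y
    using that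
  proof (induction rule: zigzag.induct)
    case (zigzag_Nil x)
    then show ?case
      using \<Psi>.AMap_Ident[of x] \<Psi>'.AMap_Ident[of x] o[of x] by (simp add: localization_def)
  next
    case (zigzag_Fwd f x y s z)
    then have "f \<in> Arr K" by (simp add: Hom_def)
    with zigzag_Fwd compose[of x "[Fwd f]" y s z] K.zigzag_single[of f x y W] a[of f] show ?case
      by (simp add: K.AMap_localization_functor)
  next
    case (zigzag_Bwd w y x s z)
    have xy: "x \<in> Obj K" "y \<in> Obj K" using zigzag_Bwd K.Dom_Obj K.Cod_Obj by (auto simp: Hom_def)
    let ?w = "AMap ?\<gamma> w" and ?v = "(x, zigzag_class K W x y [Bwd w], y)"
    have w: "?w \<in> Hom (localization K W) y x"
      using K.zigzag_single[OF zigzag_Bwd(2), of W] K.AMap_localization_functor[OF zigzag_Bwd(2)]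
      by (auto simp: Hom_localization)
    have v: "?v \<in> Hom (localization K W) x y"
      using K.zigzag_single_inverse[OF zigzag_Bwd(2,1)] by (auto simp: Hom_localization)
    note i = K.localization_inverse[OF zigzag_Bwd(2,1)]
    have "AMap \<Psi> ?v = AMap \<Psi>' ?v"
    proof (rule \<Psi>.target.inverse_unique)
      show "AMap \<Psi> ?w \<in> Hom L (OMap \<Psi> y) (OMap \<Psi> x)" by (rule \<Psi>.AMap_Hom[OF w])
      show "AMap \<Psi> ?v \<in> Hom L (OMap \<Psi> x) (OMap \<Psi> y)" by (rule \<Psi>.AMap_Hom[OF v])
      show "AMap \<Psi>' ?v \<in> Hom L (OMap \<Psi> x) (OMap \<Psi> y)" using \<Psi>'.AMap_Hom[OF v] o xy by simp
      show "Comp L (AMap \<Psi> ?v) (AMap \<Psi> ?w) = Ident L (OMap \<Psi> y)"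
        using \<Psi>.AMap_Comp[OF w v] i(1) \<Psi>.AMap_Ident[of y] xy Obj by simp
      have "w \<in> Arr K" using zigzag_Bwd by (simp add: Hom_def)
      then show "Comp L (AMap \<Psi> ?w) (AMap \<Psi>' ?v) = Ident L (OMap \<Psi> x)"
        using \<Psi>'.AMap_Comp[OF v w] i(2) \<Psi>'.AMap_Ident[of x] xy Obj o a by simp
    qed
    with zigzag_Bwd compose[of x "[Bwd w]" y s z] K.zigzag_single_inverse[of w y x W] show ?case
      by simp
  qed
  then show "\<forall>f \<in> Arr (localization K W). AMap \<Psi> f = AMap \<Psi>' f"
    by (auto simp: localization_def)
qed

end

theory Submission
  imports Defs
begin

text \<open>
  Write \<open>\<rho>\<close> for the reflection into \<open>F\<close> and \<open>\<kappa>\<close> for the coreflection into \<open>C\<close>. Condition 4 says that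
  \<open>\<rho> (\<kappa> x)\<close> and \<open>\<kappa> (\<rho> x)\<close> are isomorphic, and condition 5 says that the maps \<open>x \<sqsubseteq> \<rho> x\<close> lift against the
  maps \<open>\<kappa> y \<sqsubseteq> y\<close>. In a model structure \<open>\<rho>\<close> and \<open>\<kappa>\<close> are fibrant and cofibrant replacement, the weak
  equivalences are the maps inverted by \<open>Q = \<rho> \<circ> \<kappa>\<close>, and \<open>Q\<close> induces the inverse of the equivalence
  from \<open>F \<inter> C\<close> to the homotopy category.

  The fibrations are not determined by \<open>F\<close> and \<open>C\<close>. The model structure built here has as acyclic
  cofibrations all maps that lift against \<open>\<kappa> z \<sqsubseteq> z\<close> for all \<open>z\<close> and against \<open>f \<sqsubseteq> 1\<close> for \<open>f \<in> F\<close>. If a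
  fibration \<open>x \<sqsubseteq> y\<close> is a weak equivalence, then the infimum of \<open>x\<close> and \<open>\<kappa> y\<close> maps to \<open>\<kappa> y\<close> by such
  an acyclic cofibration, so \<open>\<kappa> y \<sqsubseteq> x\<close>. Hence the acyclic fibrations are the fibrations with the right
  lifting property against \<open>0 \<sqsubseteq> c\<close> for \<open>c \<in> C\<close>, and both weak factorization systems exist because
  they are generated or cogenerated by a class of maps.
\<close>

section \<open>Natural transformations out of a localization\<close>

context category
begin

lemma is_iso_Comp:
  assumes "f \<in> Hom K x y" "g \<in> Hom K y z" "is_iso K f" "is_iso K g"
  shows "is_iso K (Comp K g f)"
proof -
  note f = inverse_arr[OF assms(3,1)] and g = inverse_arr[OF assms(4,2)]
  let ?f = "inverse_arr K f" and ?g = "inverse_arr K g"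
  have gf: "Comp K g f \<in> Hom K x z" and inv: "Comp K ?f ?g \<in> Hom K z x"
    using assms f g by (auto intro: Comp_Hom)
  have "Comp K (Comp K ?f ?g) (Comp K g f) = Comp K ?f (Comp K ?g (Comp K g f))"
    using Comp_assoc[OF gf g(1) f(1)] by simp
  also have "\<dots> = Comp K ?f f"
    using Comp_assoc[OF assms(1,2) g(1)] g(2) Comp_Ident_left[OF assms(1)] by simp
  finally have 1: "Comp K (Comp K ?f ?g) (Comp K g f) = Ident K x" using f(2) by simp
  have "Comp K (Comp K g f) (Comp K ?f ?g) = Comp K g (Comp K f (Comp K ?f ?g))"
    using Comp_assoc[OF inv assms(1,2)] by simp
  also have "\<dots> = Comp K g ?g"
    using Comp_assoc[OF g(1) f(1) assms(1)] f(3) Comp_Ident_left[OF g(1)] by simp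
  finally have 2: "Comp K (Comp K g f) (Comp K ?f ?g) = Ident K z" using g(3) by simp
  from gf have "Comp K g f \<in> Arr K" "Dom K (Comp K g f) = x" "Cod K (Comp K g f) = z"
    by (auto simp: Hom_def)
  with 1 2 inv show ?thesis unfolding is_iso_def by auto
qed

lemma is_iso_inverse_arr:
  assumes "f \<in> Hom K x y" "is_iso K f"
  shows "is_iso K (inverse_arr K f)"
proof -
  note f = inverse_arr[OF assms(2,1)]
  from f(1) have "inverse_arr K f \<in> Arr K" "Dom K (inverse_arr K f) = y" "Cod K (inverse_arr K f) = x"
    by (auto simp: Hom_def)
  with f(2,3) assms(1) show ?thesis unfolding is_iso_def by auto
qed

end

text \<open>Insert \<open>u\<close> and its inverse to the right of \<open>a\<close>, cross the
  square, then cancel \<open>u'\<close>. This handles the backward leg of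
  \<open>zigzag_to\<close>.\<close>

lemma (in category) inverse_arr_natural:
  assumes u: "u \<in> Hom K k q" "is_iso K u" and u': "u' \<in> Hom K k' q'" "is_iso K u'"
    and a: "a \<in> Hom K q q'" and b: "b \<in> Hom K k k'" and square: "Comp K a u = Comp K u' b"
  shows "Comp K (inverse_arr K u') a = Comp K b (inverse_arr K u)"
proof -
  note v = inverse_arr[OF u(2,1)] and v' = inverse_arr[OF u'(2,1)]
  let ?v = "inverse_arr K u" and ?v' = "inverse_arr K u'"
  have "Comp K ?v' a = Comp K ?v' (Comp K a (Comp K u ?v))"
    using v(3) Comp_Ident_right[OF a] by simp
  also have "\<dots> = Comp K ?v' (Comp K u' (Comp K b ?v))"
    using Comp_assoc[OF v(1) u(1) a] Comp_assoc[OF v(1) b u'(1)] square by simp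
  also have "\<dots> = Comp K b ?v"
    using Comp_assoc[OF Comp_Hom[OF v(1) b] u'(1) v'(1)] v'(2) Comp_Ident_left[OF Comp_Hom[OF v(1) b]]
    by simp
  finally show ?thesis .
qed

lemma functor_between_comp:
  assumes "functor_between K L \<Phi>" "functor_between L M \<Psi>"
  shows "functor_between K M (comp_functor \<Psi> \<Phi>)"
proof -
  interpret \<Phi>: functor_between K L \<Phi> by fact
  interpret \<Psi>: functor_between L M \<Psi> by fact
  show ?thesis
    by unfold_locales
      (auto simp: comp_functor_def \<Phi>.OMap_Obj \<Psi>.OMap_Obj \<Phi>.AMap_Ident \<Psi>.AMap_Ident
        \<Phi>.AMap_Comp \<Psi>.AMap_Comp[OF \<Phi>.AMap_Hom \<Phi>.AMap_Hom]
        intro: \<Phi>.AMap_Hom \<Psi>.AMap_Hom)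
qed

lemma functor_between_id: "category K \<Longrightarrow> functor_between K K id_functor"
  by (simp add: functor_between_def functor_between_axioms_def id_functor_def)

text \<open>Arrows of the localization are composites of images of arrows of \<open>K\<close> and of
  inverses of images of arrows in \<open>W\<close>. Naturality squares paste along composites and
  reverse along inverses, so the squares over \<open>K\<close> suffice.\<close>

lemma natural_on_localization:
  assumes K: "category K"
    and \<Phi>: "functor_between (localization K W) L \<Phi>"
    and \<Psi>: "functor_between (localization K W) L \<Psi>"
    and \<eta>: "\<And>x. x \<in> Obj K \<Longrightarrow> \<eta> x \<in> Hom L (OMap \<Phi> x) (OMap \<Psi> x)"
    and natural: "\<And>f x y. f \<in> Hom K x y \<Longrightarrow>
      Comp L (\<eta> y) (AMap \<Phi> (AMap (localization_functor K W) f))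
        = Comp L (AMap \<Psi> (AMap (localization_functor K W) f)) (\<eta> x)"
    and g: "g \<in> Hom (localization K W) x y"
  shows "Comp L (\<eta> y) (AMap \<Phi> g) = Comp L (AMap \<Psi> g) (\<eta> x)"
proof -
  interpret K: category K by (rule K)
  interpret \<Phi>: functor_between "localization K W" L \<Phi> by fact
  interpret \<Psi>: functor_between "localization K W" L \<Psi> by fact
  let ?H = "localization K W" and ?\<gamma> = "localization_functor K W"
  define nat where "nat x y g \<longleftrightarrow> Comp L (\<eta> y) (AMap \<Phi> g) = Comp L (AMap \<Psi> g) (\<eta> x)" for x y g
  have Obj: "Obj ?H = Obj K" by (simp add: localization_def)
  have nat_Comp: "nat x z (Comp ?H h g)"
    if "nat x y g" "nat y z h" "g \<in> Hom ?H x y" "h \<in> Hom ?H y z" for x y z g h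
  proof -
    have o: "x \<in> Obj K" "y \<in> Obj K" "z \<in> Obj K"
      using that(3,4) \<Phi>.source.Dom_Obj[of g] \<Phi>.source.Cod_Obj[of g] \<Phi>.source.Cod_Obj[of h]
      by (auto simp: Hom_def Obj)
    note e = \<eta>[OF o(1)] \<eta>[OF o(2)] \<eta>[OF o(3)]
    note p = \<Phi>.AMap_Hom[OF that(3)] \<Phi>.AMap_Hom[OF that(4)]
      \<Psi>.AMap_Hom[OF that(3)] \<Psi>.AMap_Hom[OF that(4)]
    have "Comp L (\<eta> z) (AMap \<Phi> (Comp ?H h g)) = Comp L (Comp L (\<eta> z) (AMap \<Phi> h)) (AMap \<Phi> g)"
      using \<Phi>.AMap_Comp[OF that(3,4)] \<Phi>.target.Comp_assoc[OF p(1,2) e(3)] by simp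
    also have "\<dots> = Comp L (AMap \<Psi> h) (Comp L (\<eta> y) (AMap \<Phi> g))"
      using that(2) \<Phi>.target.Comp_assoc[OF p(1) e(2) p(4)] by (simp add: nat_def)
    also have "\<dots> = Comp L (AMap \<Psi> (Comp ?H h g)) (\<eta> x)"
      using that(1) \<Psi>.AMap_Comp[OF that(3,4)] \<Phi>.target.Comp_assoc[OF e(1) p(3,4)]
      by (simp add: nat_def)
    finally show ?thesis by (simp add: nat_def)
  qed
  \<comment> \<open>Write the identity as \<open>AMap \<Psi> h\<close> after
    \<open>AMap \<Psi> g\<close>, move \<open>\<eta>\<close> through the square for
    \<open>g\<close>, and cancel \<open>AMap \<Phi> g\<close> against
    \<open>AMap \<Phi> h\<close>.\<close>
  have nat_inverse: "nat y x h"
    if "nat x y g" "g \<in> Hom ?H x y" "h \<in> Hom ?H y x"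
      and inv: "Comp ?H h g = Ident ?H x" "Comp ?H g h = Ident ?H y" for x y g h
  proof -
    have o: "x \<in> Obj ?H" "y \<in> Obj ?H"
      using that(2) \<Phi>.source.Dom_Obj[of g] \<Phi>.source.Cod_Obj[of g] by (auto simp: Hom_def)
    note e = \<eta>[OF o(1)[unfolded Obj]] \<eta>[OF o(2)[unfolded Obj]]
    note p = \<Phi>.AMap_Hom[OF that(2)] \<Phi>.AMap_Hom[OF that(3)]
      \<Psi>.AMap_Hom[OF that(2)] \<Psi>.AMap_Hom[OF that(3)]
    note c = \<Phi>.target.Comp_Hom[OF p(2) e(1)]
    have "Comp L (\<eta> x) (AMap \<Phi> h) = Comp L (Comp L (AMap \<Psi> h) (AMap \<Psi> g)) (Comp L (\<eta> x) (AMap \<Phi> h))"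
      using \<Psi>.AMap_Comp[OF that(2,3)] inv \<Psi>.AMap_Ident[OF o(1)] \<Phi>.target.Comp_Ident_left[OF c]
      by simp
    also have "\<dots> = Comp L (AMap \<Psi> h) (Comp L (Comp L (AMap \<Psi> g) (\<eta> x)) (AMap \<Phi> h))"
      using \<Phi>.target.Comp_assoc[OF c p(3,4)] \<Phi>.target.Comp_assoc[OF p(2) e(1) p(3)] by simp
    also have "\<dots> = Comp L (AMap \<Psi> h) (Comp L (\<eta> y) (Comp L (AMap \<Phi> g) (AMap \<Phi> h)))"
      using that(1) \<Phi>.target.Comp_assoc[OF p(2,1) e(2)] by (simp add: nat_def)
    also have "\<dots> = Comp L (AMap \<Psi> h) (\<eta> y)"
      using \<Phi>.AMap_Comp[OF that(3,2)] inv \<Phi>.AMap_Ident[OF o(2)] \<Phi>.target.Comp_Ident_right[OF e(2)]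
      by simp
    finally show ?thesis by (simp add: nat_def)
  qed
  have nat_functor: "nat x y (AMap ?\<gamma> f)" if "f \<in> Hom K x y" for f x y
    using natural[OF that] by (simp add: nat_def)
  have "nat x y (x, zigzag_class K W x y s, y)" if "zigzag K W x s y" for x y s
    using that
  proof (induction rule: zigzag.induct)
    case (zigzag_Nil x)
    then have "x \<in> Obj ?H" by (simp add: Obj)
    from \<Phi>.AMap_Ident[OF this] \<Psi>.AMap_Ident[OF this] \<eta>[OF zigzag_Nil] show ?case
      using \<Phi>.target.Comp_Ident_left \<Phi>.target.Comp_Ident_right
      by (simp add: nat_def localization_def)
  next
    case (zigzag_Fwd f x y s z)
    note f = K.zigzag_single[OF zigzag_Fwd(1), of W]
    have "nat x z (Comp ?H (y, zigzag_class K W y z s, z) (AMap ?\<gamma> f))"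
      using zigzag_Fwd f by (intro nat_Comp[OF nat_functor])
        (auto simp: K.AMap_localization_functor Hom_localization)
    then show ?case
      using localization_Comp[OF f zigzag_Fwd(2)] K.AMap_localization_functor[OF zigzag_Fwd(1)] by simp
  next
    case (zigzag_Bwd w y x s z)
    note w = K.zigzag_single_inverse[OF zigzag_Bwd(2,1)] K.zigzag_single[OF zigzag_Bwd(2), of W]
    note i = K.localization_inverse[OF zigzag_Bwd(2,1)]
    have "nat x y (x, zigzag_class K W x y [Bwd w], y)"
      using w i zigzag_Bwd(2) by (intro nat_inverse[OF nat_functor, of w y x])
        (auto simp: K.AMap_localization_functor Hom_localization)
    then have "nat x z (Comp ?H (y, zigzag_class K W y z s, z) (x, zigzag_class K W x y [Bwd w], y))"
      using zigzag_Bwd w by (intro nat_Comp) (auto simp: Hom_localization)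
    then show ?case using localization_Comp[OF w(1) zigzag_Bwd(3)] by simp
  qed
  then show ?thesis using g by (auto simp: Hom_localization nat_def)
qed

section \<open>Lifting properties in a bicomplete preorder\<close>

lemma ball_pair_iff: "(\<forall>f\<in>S. P f) \<longleftrightarrow> (\<forall>x y. (x, y) \<in> S \<longrightarrow> P (x, y))"
  by auto

lemma bex_pair_iff: "(\<exists>f\<in>S. P f) \<longleftrightarrow> (\<exists>x y. (x, y) \<in> S \<and> P (x, y))"
  by auto

lemma preorder_cat_simps [simp]:
  "Obj (preorder_cat A r) = A" "Arr (preorder_cat A r) = r"
  "Dom (preorder_cat A r) = fst" "Cod (preorder_cat A r) = snd"
  "Ident (preorder_cat A r) x = (x, x)" "Comp (preorder_cat A r) g f = (fst f, snd g)"
  by (simp_all add: preorder_cat_def)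

locale bicomplete_preorder =
  fixes A :: "'a set" and r :: "'a rel"
  assumes preorder: "preorder_on A r" and bicomplete: "bicomplete A r"
begin

abbreviation le (infix "\<sqsubseteq>" 50) where "x \<sqsubseteq> y \<equiv> (x, y) \<in> r"

abbreviation K where "K \<equiv> preorder_cat A r"

sublocale category K using preorder by (rule category_preorder_cat)

lemma r_subset: "x \<sqsubseteq> y \<Longrightarrow> x \<in> A \<and> y \<in> A"
  using Dom_Obj[of "(x, y)"] Cod_Obj[of "(x, y)"] by simp

lemma refl: "x \<in> A \<Longrightarrow> x \<sqsubseteq> x"
  using preorder by (simp add: preorder_on_def refl_on_def)

lemma trans: "x \<sqsubseteq> y \<Longrightarrow> y \<sqsubseteq> z \<Longrightarrow> x \<sqsubseteq> z"
  using preorder transD[of r x y z] by (simp add: preorder_on_def)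

section \<open>Infima, suprema and extreme elements\<close>

lemma obtain_inf:
  assumes "S \<subseteq> A"
  obtains m where "m \<in> A" "\<And>s. s \<in> S \<Longrightarrow> m \<sqsubseteq> s"
    "\<And>k. k \<in> A \<Longrightarrow> (\<And>s. s \<in> S \<Longrightarrow> k \<sqsubseteq> s) \<Longrightarrow> k \<sqsubseteq> m"
proof -
  obtain m where "is_greatest r {k \<in> A. \<forall>s \<in> S. k \<sqsubseteq> s} m"
    using bicomplete assms bicomplete_iff[OF preorder] by auto
  then show ?thesis by (intro that[of m]) (auto simp: is_greatest_def)
qed

lemma obtain_sup:
  assumes "S \<subseteq> A"
  obtains m where "m \<in> A" "\<And>s. s \<in> S \<Longrightarrow> s \<sqsubseteq> m"
    "\<And>k. k \<in> A \<Longrightarrow> (\<And>s. s \<in> S \<Longrightarrow> s \<sqsubseteq> k) \<Longrightarrow> m \<sqsubseteq> k"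
proof -
  obtain m where "is_least r {k \<in> A. \<forall>s \<in> S. s \<sqsubseteq> k} m"
    using bicomplete assms bicomplete_iff[OF preorder] by auto
  then show ?thesis by (intro that[of m]) (auto simp: is_least_def)
qed

lemma obtain_top: obtains t where "\<And>x. x \<in> A \<Longrightarrow> x \<sqsubseteq> t" "t \<in> A"
  by (rule obtain_inf[of "{}"]) auto

lemma obtain_bot: obtains t where "\<And>x. x \<in> A \<Longrightarrow> t \<sqsubseteq> x" "t \<in> A"
  by (rule obtain_sup[of "{}"]) auto

text \<open>Every square in a preorder commutes, so a lifting problem asks only whether the diagonal
  exists.\<close>

lemma lifts_iff: "lifts K f g \<longleftrightarrow> (fst f \<sqsubseteq> fst g \<longrightarrow> snd f \<sqsubseteq> snd g \<longrightarrow> snd f \<sqsubseteq> fst g)"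
  by (auto simp: lifts_def Hom_preorder_cat)

lemma llp_iff:
  "(a, b) \<in> llp K R \<longleftrightarrow> a \<sqsubseteq> b \<and> (\<forall>(x, y) \<in> R. a \<sqsubseteq> x \<longrightarrow> b \<sqsubseteq> y \<longrightarrow> b \<sqsubseteq> x)"
  by (auto simp: llp_def lifts_iff)

lemma rlp_iff:
  "(x, y) \<in> rlp K L \<longleftrightarrow> x \<sqsubseteq> y \<and> (\<forall>(a, b) \<in> L. a \<sqsubseteq> x \<longrightarrow> b \<sqsubseteq> y \<longrightarrow> b \<sqsubseteq> x)"
  by (auto simp: rlp_def lifts_iff)

lemma is_initial_iff: "is_initial K i \<longleftrightarrow> i \<in> A \<and> (\<forall>x \<in> A. i \<sqsubseteq> x)"
  by (auto simp: is_initial_def Hom_preorder_cat)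

lemma is_terminal_iff: "is_terminal K t \<longleftrightarrow> t \<in> A \<and> (\<forall>x \<in> A. x \<sqsubseteq> t)"
  by (auto simp: is_terminal_def Hom_preorder_cat)

lemma fibrant_objects_iff:
  "x \<in> fibrant_objects K fib \<longleftrightarrow> x \<in> A \<and> (\<exists>t. is_terminal K t \<and> (x, t) \<in> fib)"
  by (auto simp: fibrant_objects_def Hom_preorder_cat is_terminal_iff split: if_splits)

lemma cofibrant_objects_iff:
  "x \<in> cofibrant_objects K cof \<longleftrightarrow> x \<in> A \<and> (\<exists>i. is_initial K i \<and> (i, x) \<in> cof)"
  by (auto simp: cofibrant_objects_def Hom_preorder_cat is_initial_iff split: if_splits)

text \<open>A section and its retraction already give both inequalities, so the ends of a retract
  are isomorphic to those of the given arrow.\<close>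

lemma retract_of_iff:
  "retract_of K (x, y) (u, v) \<longleftrightarrow>
    x \<sqsubseteq> y \<and> u \<sqsubseteq> v \<and> isomorphic_in r x u \<and> isomorphic_in r y v"
  by (auto simp: retract_of_def Hom_preorder_cat isomorphic_in_def)

lemma retract_closed_iff:
  assumes "S \<subseteq> r"
  shows "retract_closed K S \<longleftrightarrow>
    (\<forall>x y u v. (u, v) \<in> S \<longrightarrow> isomorphic_in r x u \<longrightarrow> isomorphic_in r y v \<longrightarrow> (x, y) \<in> S)"
proof -
  have "retract_of K (x, y) (u, v) \<longleftrightarrow> isomorphic_in r x u \<and> isomorphic_in r y v"
    if "(u, v) \<in> S" for x y u v
  proof -
    have "x \<sqsubseteq> y" if "x \<sqsubseteq> u" "v \<sqsubseteq> y"
      using trans[OF trans[OF that(1)] that(2)] assms \<open>(u, v) \<in> S\<close> by blast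
    with assms that show ?thesis by (auto simp: retract_of_iff isomorphic_in_def)
  qed
  then show ?thesis unfolding retract_closed_def split_paired_All by blast
qed

lemma wide_subcategory_iff:
  "wide_subcategory K S \<longleftrightarrow> S \<subseteq> r \<and> (\<forall>x \<in> A. (x, x) \<in> S) \<and>
     (\<forall>x y z. (x, y) \<in> S \<longrightarrow> (y, z) \<in> S \<longrightarrow> (x, z) \<in> S)"
  unfolding wide_subcategory_def ball_pair_iff preorder_cat_simps fst_conv snd_conv by blast

lemma two_out_of_three_iff:
  "two_out_of_three K W \<longleftrightarrow> (\<forall>x y z. x \<sqsubseteq> y \<longrightarrow> y \<sqsubseteq> z \<longrightarrow>
        ((x, y) \<in> W \<and> (y, z) \<in> W \<longrightarrow> (x, z) \<in> W) \<and>
        ((x, y) \<in> W \<and> (x, z) \<in> W \<longrightarrow> (y, z) \<in> W) \<and>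
        ((y, z) \<in> W \<and> (x, z) \<in> W \<longrightarrow> (x, y) \<in> W))"
  unfolding two_out_of_three_def preorder_cat_simps ball_pair_iff fst_conv snd_conv by blast

text \<open>A square out of a composite is filled over the first factor and then over the second;
  for retracts the ends are moved along isomorphisms.\<close>

lemma llp_subcategory: "wide_subcategory K (llp K R)" "retract_closed K (llp K R)"
proof -
  have sub: "llp K R \<subseteq> r" by (auto simp: llp_def)
  have "(x, z) \<in> llp K R" if "(x, y) \<in> llp K R" "(y, z) \<in> llp K R" for x y z
    unfolding llp_iff
  proof safe
    show "x \<sqsubseteq> z" using that trans[of x y z] by (simp add: llp_iff)
    fix a b assume "(a, b) \<in> R" "x \<sqsubseteq> a" "z \<sqsubseteq> b"
    moreover from this have "y \<sqsubseteq> b" using that(2) trans[of y z b] by (simp add: llp_iff)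
    ultimately show "z \<sqsubseteq> a" using that by (auto simp: llp_iff)
  qed
  moreover have "\<forall>x \<in> A. (x, x) \<in> llp K R" by (simp add: llp_iff refl split_def)
  ultimately show "wide_subcategory K (llp K R)"
    unfolding wide_subcategory_iff using sub by blast
  have "(x, y) \<in> llp K R"
    if uv: "(u, v) \<in> llp K R" and iso: "x \<sqsubseteq> u" "u \<sqsubseteq> x" "y \<sqsubseteq> v" "v \<sqsubseteq> y" for x y u v
    unfolding llp_iff
  proof safe
    show "x \<sqsubseteq> y" using uv trans[OF trans[OF iso(1)] iso(4)] by (simp add: llp_iff)
    fix a b assume ab: "(a, b) \<in> R" "x \<sqsubseteq> a" "y \<sqsubseteq> b"
    then have "v \<sqsubseteq> a" using uv trans[OF iso(2) ab(2)] trans[OF iso(4) ab(3)] unfolding llp_iff by blast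
    with iso(3) show "y \<sqsubseteq> a" by (rule trans)
  qed
  then show "retract_closed K (llp K R)"
    unfolding retract_closed_iff[OF sub] isomorphic_in_def by blast
qed

lemma rlp_subcategory: "wide_subcategory K (rlp K L)" "retract_closed K (rlp K L)"
proof -
  have sub: "rlp K L \<subseteq> r" by (auto simp: rlp_def)
  have "(x, z) \<in> rlp K L" if "(x, y) \<in> rlp K L" "(y, z) \<in> rlp K L" for x y z
    unfolding rlp_iff
  proof safe
    show "x \<sqsubseteq> z" using that trans[of x y z] by (simp add: rlp_iff)
    fix a b assume "(a, b) \<in> L" "a \<sqsubseteq> x" "b \<sqsubseteq> z"
    moreover from this have "a \<sqsubseteq> y" using that(1) trans[of a x y] by (simp add: rlp_iff)
    ultimately show "b \<sqsubseteq> x" using that by (auto simp: rlp_iff)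
  qed
  moreover have "\<forall>x \<in> A. (x, x) \<in> rlp K L" by (simp add: rlp_iff refl split_def)
  ultimately show "wide_subcategory K (rlp K L)"
    unfolding wide_subcategory_iff using sub by blast
  have "(x, y) \<in> rlp K L"
    if uv: "(u, v) \<in> rlp K L" and iso: "x \<sqsubseteq> u" "u \<sqsubseteq> x" "y \<sqsubseteq> v" "v \<sqsubseteq> y" for x y u v
    unfolding rlp_iff
  proof safe
    show "x \<sqsubseteq> y" using uv trans[OF trans[OF iso(1)] iso(4)] by (simp add: rlp_iff)
    fix a b assume ab: "(a, b) \<in> L" "a \<sqsubseteq> x" "b \<sqsubseteq> y"
    then have "b \<sqsubseteq> u" using uv trans[OF ab(2) iso(1)] trans[OF ab(3) iso(3)] unfolding rlp_iff by blast
    then show "b \<sqsubseteq> x" using iso(2) by (rule trans)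
  qed
  then show "retract_closed K (rlp K L)"
    unfolding retract_closed_iff[OF sub] isomorphic_in_def by blast
qed

text \<open>This and the dual \<open>rlp_llp_rlp\<close> are the triangle identities of the antitone
  Galois connection between \<open>llp K\<close> and \<open>rlp K\<close> on subsets of
  \<open>r\<close>.\<close>

lemma llp_rlp_llp: "llp K (rlp K (llp K R)) = llp K R" if "R \<subseteq> r"
  using that by (auto simp: llp_def rlp_def)

lemma rlp_llp_rlp: "rlp K (llp K (rlp K L)) = rlp K L" if "L \<subseteq> r"
  using that by (auto simp: llp_def rlp_def)

section \<open>Existence of weak factorization systems\<close>

lemma wfs_factorization_iff:
  "(\<forall>f \<in> Arr K. \<exists>l \<in> L. \<exists>g \<in> R. Cod K l = Dom K g \<and> f = Comp K g l) \<longleftrightarrow>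
    (\<forall>x y. x \<sqsubseteq> y \<longrightarrow> (\<exists>w. (x, w) \<in> L \<and> (w, y) \<in> R))"
  unfolding preorder_cat_simps ball_pair_iff bex_pair_iff by auto

text \<open>The middle object of a factorization of \<open>x \<sqsubseteq> y\<close> is the supremum of those below \<open>y\<close> that are
  reached from \<open>x\<close> by a left map; dually in \<open>wfs_generated\<close>.\<close>

lemma wfs_cogenerated:
  assumes S: "S \<subseteq> r"
  shows "weak_factorization_system K (llp K S) (rlp K (llp K S))"
  unfolding weak_factorization_system_def wfs_factorization_iff
proof (intro conjI allI impI)
  fix x y assume xy: "x \<sqsubseteq> y"
  let ?W = "{w. (x, w) \<in> llp K S \<and> w \<sqsubseteq> y}"
  have "?W \<subseteq> A" by (auto dest: r_subset)
  then obtain w where w: "w \<in> A" "\<And>s. s \<in> ?W \<Longrightarrow> s \<sqsubseteq> w"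
    "\<And>k. k \<in> A \<Longrightarrow> (\<And>s. s \<in> ?W \<Longrightarrow> s \<sqsubseteq> k) \<Longrightarrow> w \<sqsubseteq> k" by (rule obtain_sup) blast
  have x: "x \<in> A" "y \<in> A" "x \<in> ?W"
    using xy r_subset[OF xy] llp_subcategory(1)[of S] by (auto simp: wide_subcategory_iff)
  have wy: "w \<sqsubseteq> y" using w(3)[OF x(2)] by blast
  \<comment> \<open>Left maps out of \<open>x\<close> are closed under suprema of their targets: in
    a square to \<open>a \<sqsubseteq> b\<close> each target separately lies below \<open>a\<close>,
    hence so does the supremum.\<close>
  have xw: "(x, w) \<in> llp K S"
    unfolding llp_iff
  proof safe
    show "x \<sqsubseteq> w" using w(2) x by blast
    fix a b assume ab: "(a, b) \<in> S" "x \<sqsubseteq> a" "w \<sqsubseteq> b"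
    show "w \<sqsubseteq> a"
    proof (rule w(3))
      show "a \<in> A" using ab r_subset by blast
      fix s assume s: "s \<in> ?W"
      then have "s \<sqsubseteq> b" using w(2) ab trans by blast
      with s ab show "s \<sqsubseteq> a" unfolding llp_iff by blast
    qed
  qed
  have "(w, y) \<in> rlp K (llp K S)"
    unfolding rlp_iff
  proof safe
    show "w \<sqsubseteq> y" by (rule wy)
    fix a b assume ab: "(a, b) \<in> llp K S" "a \<sqsubseteq> w" "b \<sqsubseteq> y"
    then have "{b, w} \<subseteq> A" using r_subset w(1) by blast
    then obtain j where j: "j \<in> A" "\<And>s. s \<in> {b, w} \<Longrightarrow> s \<sqsubseteq> j"
      "\<And>k. k \<in> A \<Longrightarrow> (\<And>s. s \<in> {b, w} \<Longrightarrow> s \<sqsubseteq> k) \<Longrightarrow> j \<sqsubseteq> k" by (rule obtain_sup) blast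
    \<comment> \<open>\<open>j\<close> is the pushout of \<open>a \<sqsubseteq> b\<close> along
      \<open>a \<sqsubseteq> w\<close>, so \<open>x \<sqsubseteq> j\<close> is again a left map and
      \<open>j\<close> competes in the supremum defining \<open>w\<close>.\<close>
    have "(x, j) \<in> llp K S"
      unfolding llp_iff
    proof safe
      show "x \<sqsubseteq> j" using w(2)[OF x(3)] j(2) trans by blast
      fix c d assume cd: "(c, d) \<in> S" "x \<sqsubseteq> c" "j \<sqsubseteq> d"
      have wd: "w \<sqsubseteq> d" "b \<sqsubseteq> d" using cd j(2) trans by blast+
      have wc: "w \<sqsubseteq> c" using xw cd wd unfolding llp_iff by blast
      then have "a \<sqsubseteq> c" using ab trans by blast
      then have "b \<sqsubseteq> c" using ab(1) cd wd unfolding llp_iff by blast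
      moreover have "c \<in> A" using cd(1) S r_subset by blast
      ultimately show "j \<sqsubseteq> c" using wc by (intro j(3)) auto
    qed
    moreover have "j \<sqsubseteq> y" using j(3)[of y] ab wy x by blast
    ultimately have "j \<sqsubseteq> w" using w(2) by blast
    then show "b \<sqsubseteq> w" using j(2) trans by blast
  qed
  with xw show "\<exists>w. (x, w) \<in> llp K S \<and> (w, y) \<in> rlp K (llp K S)" by blast
qed (simp_all add: llp_rlp_llp S)

lemma wfs_generated:
  assumes S: "S \<subseteq> r"
  shows "weak_factorization_system K (llp K (rlp K S)) (rlp K S)"
  unfolding weak_factorization_system_def wfs_factorization_iff
proof (intro conjI allI impI)
  fix x y assume xy: "x \<sqsubseteq> y"
  let ?W = "{w. (w, y) \<in> rlp K S \<and> x \<sqsubseteq> w}"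
  have "?W \<subseteq> A" by (auto dest: r_subset)
  then obtain w where w: "w \<in> A" "\<And>s. s \<in> ?W \<Longrightarrow> w \<sqsubseteq> s"
    "\<And>k. k \<in> A \<Longrightarrow> (\<And>s. s \<in> ?W \<Longrightarrow> k \<sqsubseteq> s) \<Longrightarrow> k \<sqsubseteq> w" by (rule obtain_inf) blast
  have y: "x \<in> A" "y \<in> A" "y \<in> ?W"
    using xy r_subset[OF xy] rlp_subcategory(1)[of S] by (auto simp: wide_subcategory_iff)
  have xw: "x \<sqsubseteq> w" using w(3)[OF y(1)] by blast
  have wy: "(w, y) \<in> rlp K S"
    unfolding rlp_iff
  proof safe
    show "w \<sqsubseteq> y" using w(2) y by blast
    fix a b assume ab: "(a, b) \<in> S" "a \<sqsubseteq> w" "b \<sqsubseteq> y"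
    show "b \<sqsubseteq> w"
    proof (rule w(3))
      show "b \<in> A" using ab r_subset by blast
      fix s assume s: "s \<in> ?W"
      then have "a \<sqsubseteq> s" using w(2) ab trans by blast
      with s ab show "b \<sqsubseteq> s" unfolding rlp_iff by blast
    qed
  qed
  have "(x, w) \<in> llp K (rlp K S)"
    unfolding llp_iff
  proof safe
    show "x \<sqsubseteq> w" by (rule xw)
    fix a b assume ab: "(a, b) \<in> rlp K S" "x \<sqsubseteq> a" "w \<sqsubseteq> b"
    then have "{a, w} \<subseteq> A" using r_subset w(1) by blast
    then obtain j where j: "j \<in> A" "\<And>s. s \<in> {a, w} \<Longrightarrow> j \<sqsubseteq> s"
      "\<And>k. k \<in> A \<Longrightarrow> (\<And>s. s \<in> {a, w} \<Longrightarrow> k \<sqsubseteq> s) \<Longrightarrow> k \<sqsubseteq> j" by (rule obtain_inf) blast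
    \<comment> \<open>Here \<open>j\<close> is the pullback of \<open>a \<sqsubseteq> b\<close>
      along \<open>w \<sqsubseteq> b\<close>, so \<open>j\<close> competes in the infimum defining
      \<open>w\<close>.\<close>
    have "(j, y) \<in> rlp K S"
      unfolding rlp_iff
    proof safe
      show "j \<sqsubseteq> y" using w(2)[OF y(3)] j(2) trans by blast
      fix c d assume cd: "(c, d) \<in> S" "c \<sqsubseteq> j" "d \<sqsubseteq> y"
      have cw: "c \<sqsubseteq> w" "c \<sqsubseteq> a" using cd j(2) trans by blast+
      have dw: "d \<sqsubseteq> w" using wy cd cw unfolding rlp_iff by blast
      then have "d \<sqsubseteq> b" using ab trans by blast
      then have "d \<sqsubseteq> a" using ab(1) cd cw unfolding rlp_iff by blast
      moreover have "d \<in> A" using cd(1) S r_subset by blast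
      ultimately show "d \<sqsubseteq> j" using dw by (intro j(3)) auto
    qed
    moreover have "x \<sqsubseteq> j" using j(3)[of x] ab xw y by blast
    ultimately have "w \<sqsubseteq> j" using w(2) by blast
    then show "w \<sqsubseteq> a" using j(2) trans by blast
  qed
  with wy show "\<exists>w. (x, w) \<in> llp K (rlp K S) \<and> (w, y) \<in> rlp K S" by blast
qed (simp_all add: rlp_llp_rlp S)

end

section \<open>Reflective and coreflective subsets\<close>

text \<open>Least and greatest elements are determined only up to isomorphism, so
  \<open>\<rho>\<close> and \<open>\<kappa>\<close> are arbitrary choices of them. The locale serves
  both directions: the choices come from the conditions or from replacements in a model
  structure.\<close>

locale reflection_pair = bicomplete_preorder +
  fixes F C :: "'a set" and \<rho> \<kappa> :: "'a \<Rightarrow> 'a"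
  assumes F_subset: "F \<subseteq> A" and C_subset: "C \<subseteq> A"
    and reflection: "\<And>x. x \<in> A \<Longrightarrow> is_least r (upper_bounds_in r F x) (\<rho> x)"
    and coreflection: "\<And>x. x \<in> A \<Longrightarrow> is_greatest r (lower_bounds_in r C x) (\<kappa> x)"
begin

lemma reflection_in: "x \<in> A \<Longrightarrow> \<rho> x \<in> F" and le_reflection: "x \<in> A \<Longrightarrow> x \<sqsubseteq> \<rho> x"
  and reflection_le: "x \<sqsubseteq> f \<Longrightarrow> f \<in> F \<Longrightarrow> \<rho> x \<sqsubseteq> f"
  using reflection[of x] by (auto simp: is_least_def upper_bounds_in_def dest: r_subset)

lemma coreflection_in: "x \<in> A \<Longrightarrow> \<kappa> x \<in> C" and coreflection_le: "x \<in> A \<Longrightarrow> \<kappa> x \<sqsubseteq> x"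
  and le_coreflection: "c \<sqsubseteq> x \<Longrightarrow> c \<in> C \<Longrightarrow> c \<sqsubseteq> \<kappa> x"
  using coreflection[of x] by (auto simp: is_greatest_def lower_bounds_in_def dest: r_subset)

lemma in_A [simp, intro]: "x \<in> A \<Longrightarrow> \<rho> x \<in> A" "x \<in> A \<Longrightarrow> \<kappa> x \<in> A"
  using reflection_in coreflection_in F_subset C_subset by auto

lemma reflection_mono: "x \<sqsubseteq> y \<Longrightarrow> \<rho> x \<sqsubseteq> \<rho> y"
  using reflection_le[of x "\<rho> y"] le_reflection[of y] reflection_in[of y] trans[of x y "\<rho> y"] r_subset[of x y]
  by blast

lemma coreflection_mono: "x \<sqsubseteq> y \<Longrightarrow> \<kappa> x \<sqsubseteq> \<kappa> y"
  using le_coreflection[of "\<kappa> x" y] coreflection_le[of x] coreflection_in[of x] trans[of "\<kappa> x" x y]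
    r_subset[of x y] by blast

text \<open>A member of \<open>F\<close> lies above every lower bound of \<open>x\<close> in
  \<open>C\<close> exactly if it lies above \<open>\<kappa> x\<close>. These members have the least
  element \<open>\<rho> (\<kappa> x)\<close>, so the minimal ones are its isomorphic copies. Dually
  the maximal elements are the copies of \<open>\<kappa> (\<rho> x)\<close> in
  \<open>C\<close>.\<close>

lemma minimal_maximal_iff:
  "(\<forall>x\<in>A. \<forall>f\<in>F. \<forall>c\<in>C.
      is_minimal r {g \<in> F. \<forall>l \<in> lower_bounds_in r C x. (l, g) \<in> r} f \<and>
      is_maximal r {d \<in> C. \<forall>u \<in> upper_bounds_in r F x. (d, u) \<in> r} c \<longrightarrow>
      isomorphic_in r f c) \<longleftrightarrow>
   (\<forall>x\<in>A. isomorphic_in r (\<rho> (\<kappa> x)) (\<kappa> (\<rho> x)))"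
proof -
  have F: "{g \<in> F. \<forall>l \<in> lower_bounds_in r C x. l \<sqsubseteq> g} = {g \<in> F. \<kappa> x \<sqsubseteq> g}"
    and C: "{d \<in> C. \<forall>u \<in> upper_bounds_in r F x. d \<sqsubseteq> u} = {d \<in> C. d \<sqsubseteq> \<rho> x}" if "x \<in> A" for x
    using reflection[OF that] coreflection[OF that] trans
    unfolding is_least_def is_greatest_def by blast+
  have minimal: "is_minimal r {g \<in> F. \<kappa> x \<sqsubseteq> g} f \<longleftrightarrow> f \<in> F \<and> isomorphic_in r f (\<rho> (\<kappa> x))"
    if x: "x \<in> A" for x f
    using reflection_le[of "\<kappa> x"] reflection_in[of "\<kappa> x"] le_reflection[of "\<kappa> x"] trans in_A(2)[OF x]
    unfolding is_minimal_def isomorphic_in_def by blast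
  have maximal: "is_maximal r {d \<in> C. d \<sqsubseteq> \<rho> x} c \<longleftrightarrow> c \<in> C \<and> isomorphic_in r c (\<kappa> (\<rho> x))"
    if x: "x \<in> A" for x c
    using le_coreflection[of _ "\<rho> x"] coreflection_in[of "\<rho> x"] coreflection_le[of "\<rho> x"] trans in_A(1)[OF x]
    unfolding is_maximal_def isomorphic_in_def by blast
  show ?thesis
  proof (intro ball_cong HOL.refl)
    fix x assume x: "x \<in> A"
    have "\<rho> (\<kappa> x) \<in> F" "\<kappa> (\<rho> x) \<in> C" using x by (auto intro: reflection_in coreflection_in)
    moreover from this have "isomorphic_in r (\<rho> (\<kappa> x)) (\<rho> (\<kappa> x))" "isomorphic_in r (\<kappa> (\<rho> x)) (\<kappa> (\<rho> x))"
      using refl F_subset C_subset by (auto simp: isomorphic_in_def)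
    ultimately show "(\<forall>f\<in>F. \<forall>c\<in>C. is_minimal r {g \<in> F. \<forall>l \<in> lower_bounds_in r C x. l \<sqsubseteq> g} f \<and>
        is_maximal r {d \<in> C. \<forall>u \<in> upper_bounds_in r F x. d \<sqsubseteq> u} c \<longrightarrow> isomorphic_in r f c)
      \<longleftrightarrow> isomorphic_in r (\<rho> (\<kappa> x)) (\<kappa> (\<rho> x))"
      unfolding F[OF x] C[OF x] minimal[OF x] maximal[OF x]
      unfolding isomorphic_in_def using trans by blast
  qed
qed

text \<open>The best bounds to use are \<open>\<kappa> y\<close> and \<open>\<rho> x\<close>; what
  remains is the lifting of \<open>x \<sqsubseteq> \<rho> x\<close> against
  \<open>\<kappa> y \<sqsubseteq> y\<close>.\<close>

lemma interpolation_iff: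
  "(\<forall>x\<in>A. \<forall>y\<in>A.
      (\<exists>l \<in> lower_bounds_in r C y. (x, l) \<in> r) \<and>
      (\<exists>u \<in> upper_bounds_in r F x. (u, y) \<in> r) \<longrightarrow>
      (\<exists>u \<in> upper_bounds_in r F x. \<exists>l \<in> lower_bounds_in r C y. (u, l) \<in> r)) \<longleftrightarrow>
   (\<forall>x\<in>A. \<forall>y\<in>A. x \<sqsubseteq> \<kappa> y \<longrightarrow> \<rho> x \<sqsubseteq> y \<longrightarrow> \<rho> x \<sqsubseteq> \<kappa> y)"
proof (intro ball_cong HOL.refl)
  fix x y assume xy: "x \<in> A" "y \<in> A"
  have "(\<exists>l \<in> lower_bounds_in r C y. z \<sqsubseteq> l) \<longleftrightarrow> z \<sqsubseteq> \<kappa> y"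
    "(\<exists>u \<in> upper_bounds_in r F x. u \<sqsubseteq> z) \<longleftrightarrow> \<rho> x \<sqsubseteq> z" for z
    using reflection[OF xy(1)] coreflection[OF xy(2)] trans
    unfolding is_least_def is_greatest_def by blast+
  then show "((\<exists>l \<in> lower_bounds_in r C y. x \<sqsubseteq> l) \<and> (\<exists>u \<in> upper_bounds_in r F x. u \<sqsubseteq> y) \<longrightarrow>
      (\<exists>u \<in> upper_bounds_in r F x. \<exists>l \<in> lower_bounds_in r C y. u \<sqsubseteq> l)) \<longleftrightarrow>
      (x \<sqsubseteq> \<kappa> y \<longrightarrow> \<rho> x \<sqsubseteq> y \<longrightarrow> \<rho> x \<sqsubseteq> \<kappa> y)" by auto
qed

section \<open>Construction of the model structure\<close>

lemma ex_model_structure: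
  assumes closed: "iso_closed A r F" "iso_closed A r C"
    and commute: "\<forall>x\<in>A. isomorphic_in r (\<rho> (\<kappa> x)) (\<kappa> (\<rho> x))"
    and interpolation: "\<forall>x\<in>A. \<forall>y\<in>A. x \<sqsubseteq> \<kappa> y \<longrightarrow> \<rho> x \<sqsubseteq> y \<longrightarrow> \<rho> x \<sqsubseteq> \<kappa> y"
  shows "\<exists>cof we fib. model_structure K cof we fib \<and> fibrant_objects K fib = F \<and>
    cofibrant_objects K cof = C"
proof -
  obtain t where t: "\<And>x. x \<in> A \<Longrightarrow> x \<sqsubseteq> t" "t \<in> A" using obtain_top by blast
  obtain b where b: "\<And>x. x \<in> A \<Longrightarrow> b \<sqsubseteq> x" "b \<in> A" using obtain_bot by blast
  have in_F: "x \<in> F" if "\<rho> x \<sqsubseteq> x" for x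
    using closed(1) that le_reflection[of x] r_subset[OF that] reflection_in[of x]
    unfolding iso_closed_def isomorphic_in_def by blast
  have in_C: "x \<in> C" if "x \<sqsubseteq> \<kappa> x" for x
    using closed(2) that coreflection_le[of x] r_subset[OF that] coreflection_in[of x]
    unfolding iso_closed_def isomorphic_in_def by blast
  \<comment> \<open>Only one inequality is recorded, because the other follows from
    \<open>x \<sqsubseteq> y\<close> by monotonicity.\<close>
  define we where "we = {(x, y). x \<sqsubseteq> y \<and> \<rho> (\<kappa> y) \<sqsubseteq> \<rho> (\<kappa> x)}"
  txt \<open>The maps \<open>\<kappa> z \<sqsubseteq> z\<close> and \<open>f \<sqsubseteq> t\<close> are fibrations in every solution, so \<open>AC\<close> is the largest
    conceivable class of acyclic cofibrations.\<close>
  define AC where "AC = llp K ({(\<kappa> z, z) | z. z \<in> A} \<union> {(f, t) | f. f \<in> F})"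
  define fib where "fib = rlp K AC"
  \<comment> \<open>Lifting against \<open>AC\<close> makes the members of \<open>AF\<close>
    fibrations; the maps \<open>b \<sqsubseteq> c\<close> are added so that members of
    \<open>C\<close> become cofibrant.\<close>
  define AF where "AF = rlp K (AC \<union> {(b, c) | c. c \<in> C})"
  define cof where "cof = llp K AF"
  \<comment> \<open>Lifting against all \<open>f \<sqsubseteq> t\<close> says that every member of
    \<open>F\<close> above \<open>x\<close> is above \<open>y\<close>, which amounts to
    \<open>\<rho> y \<sqsubseteq> \<rho> x\<close>.\<close>
  have AC: "(x, y) \<in> AC \<longleftrightarrow> x \<sqsubseteq> y \<and> \<rho> y \<sqsubseteq> \<rho> x \<and> (\<forall>z\<in>A. x \<sqsubseteq> \<kappa> z \<longrightarrow> y \<sqsubseteq> z \<longrightarrow> y \<sqsubseteq> \<kappa> z)" for x y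
  proof (cases "x \<sqsubseteq> y")
    case True
    then have xy: "x \<in> A" "y \<in> A" using r_subset by auto
    have "(\<forall>f\<in>F. x \<sqsubseteq> f \<longrightarrow> y \<sqsubseteq> t \<longrightarrow> y \<sqsubseteq> f) \<longleftrightarrow> \<rho> y \<sqsubseteq> \<rho> x"
      using reflection_le le_reflection[OF xy(1)] le_reflection[OF xy(2)] reflection_in[OF xy(1)] t(1)[OF xy(2)] trans
      by blast
    with True show ?thesis by (auto simp: AC_def llp_iff)
  qed (auto simp: AC_def llp_iff)
  have fib_coreflection: "(\<kappa> z, z) \<in> fib" if "z \<in> A" for z
    using that coreflection_le by (auto simp: fib_def rlp_iff AC)
  have fib_F: "(f, t) \<in> fib" if "f \<in> F" for f
    unfolding fib_def rlp_iff
  proof safe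
    show "f \<sqsubseteq> t" using that F_subset t by blast
    fix x y assume "(x, y) \<in> AC" "x \<sqsubseteq> f"
    then show "y \<sqsubseteq> f"
      using that reflection_le[of x f] le_reflection[of y] r_subset[of x y] trans by (metis AC)
  qed
  \<comment> \<open>The lifting against \<open>\<kappa> z \<sqsubseteq> z\<close> is the hypothesis
    \<open>interpolation\<close>; the other clause is idempotence of \<open>\<rho>\<close>.\<close>
  have AC_reflection: "(x, \<rho> x) \<in> AC" if "x \<in> A" for x
    using that le_reflection reflection_le[of "\<rho> x" "\<rho> x"] refl reflection_in interpolation
    by (auto simp: AC)
  have Q_mono: "\<rho> (\<kappa> x) \<sqsubseteq> \<rho> (\<kappa> y)" if "x \<sqsubseteq> y" for x y
    using that by (intro reflection_mono coreflection_mono)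
  have AC_we: "AC \<subseteq> we"
  proof safe
    fix x y assume "(x, y) \<in> AC"
    then have *: "x \<sqsubseteq> y" "\<rho> y \<sqsubseteq> \<rho> x" by (auto simp: AC)
    \<comment> \<open>\<open>AC\<close> controls \<open>\<rho>\<close> whereas \<open>we\<close> is
      defined by \<open>\<rho> \<circ> \<kappa>\<close>. Applying \<open>\<kappa>\<close> afterwards
      and exchanging the two by \<open>commute\<close> bridges the gap.\<close>
    then have "\<kappa> (\<rho> y) \<sqsubseteq> \<kappa> (\<rho> x)" by (intro coreflection_mono)
    then have "\<rho> (\<kappa> y) \<sqsubseteq> \<rho> (\<kappa> x)"
      using commute r_subset[OF *(1)] trans unfolding isomorphic_in_def by blast
    with * show "(x, y) \<in> we" by (simp add: we_def)
  qed
  have AF: "AF = we \<inter> fib"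
  proof safe
    fix x y assume AF: "(x, y) \<in> AF"
    then show "(x, y) \<in> fib" by (auto simp: AF_def fib_def rlp_iff)
    from AF have xy: "x \<sqsubseteq> y" by (simp add: AF_def rlp_iff)
    then have "x \<in> A" "y \<in> A" using r_subset by auto
    \<comment> \<open>The generator \<open>b \<sqsubseteq> \<kappa> y\<close> lifts against
      \<open>x \<sqsubseteq> y\<close>.\<close>
    then have "\<kappa> y \<sqsubseteq> x"
      using AF b coreflection_in[of y] coreflection_le[of y] by (auto simp: AF_def rlp_iff)
    then have "\<kappa> y \<sqsubseteq> \<kappa> x" using coreflection_in[OF \<open>y \<in> A\<close>] le_coreflection by blast
    with xy show "(x, y) \<in> we" by (simp add: we_def reflection_mono)
  next
    fix x y assume we: "(x, y) \<in> we" and fib: "(x, y) \<in> fib"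
    from we have xy: "x \<sqsubseteq> y" "x \<in> A" "y \<in> A" "\<rho> (\<kappa> y) \<sqsubseteq> \<rho> (\<kappa> x)"
      using r_subset by (auto simp: we_def)
    then have "{x, \<kappa> y} \<subseteq> A" by auto
    then obtain m where m: "m \<in> A" "\<And>s. s \<in> {x, \<kappa> y} \<Longrightarrow> m \<sqsubseteq> s"
      "\<And>k. k \<in> A \<Longrightarrow> (\<And>s. s \<in> {x, \<kappa> y} \<Longrightarrow> k \<sqsubseteq> s) \<Longrightarrow> k \<sqsubseteq> m" by (rule obtain_inf) blast
    \<comment> \<open>\<open>m\<close> is the pullback of \<open>x \<sqsubseteq> y\<close> along
      \<open>\<kappa> y \<sqsubseteq> y\<close>. Since \<open>\<kappa> x\<close> lies below it,
      \<open>\<rho>\<close> inverts \<open>m \<sqsubseteq> \<kappa> y\<close>.\<close>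
    have "\<kappa> x \<sqsubseteq> m"
      using coreflection_le[OF xy(2)] coreflection_mono[OF xy(1)] xy(2) by (intro m(3)) auto
    then have "\<rho> (\<kappa> y) \<sqsubseteq> \<rho> m" using xy(4) trans reflection_mono by blast
    \<comment> \<open>The lifting clause of \<open>AC\<close> holds because the target lies in
      \<open>C\<close>: below \<open>z\<close> it is also below \<open>\<kappa> z\<close>.\<close>
    then have "(m, \<kappa> y) \<in> AC"
      using m(2) coreflection_in[OF xy(3)] le_coreflection by (auto simp: AC)
    then have "\<kappa> y \<sqsubseteq> x"
      using fib m(2) coreflection_le[OF xy(3)] by (auto simp: fib_def rlp_iff)
    then have "c \<sqsubseteq> x" if "c \<in> C" "c \<sqsubseteq> y" for c
      using le_coreflection[OF that(2,1)] trans by blast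
    with fib show "(x, y) \<in> AF" by (auto simp: AF_def fib_def rlp_iff)
  qed
  have wfs1: "weak_factorization_system K AC fib"
    unfolding AC_def fib_def by (rule wfs_cogenerated) (use coreflection_le t F_subset in auto)
  have AC_sub: "AC \<subseteq> r" by (auto simp: AC)
  have AC_retract: "retract_closed K AC" unfolding AC_def by (rule llp_subcategory)
  have wfs2: "weak_factorization_system K cof (we \<inter> fib)"
    unfolding AF[symmetric] cof_def
    unfolding AF_def by (rule wfs_generated) (use AC_sub b C_subset in auto)
  have two3: "two_out_of_three K we"
    unfolding two_out_of_three_iff we_def using Q_mono trans by blast
  have AC_eq: "cof \<inter> we = AC"
  proof
    show "AC \<subseteq> cof \<inter> we"
      using AC_we AC_sub unfolding cof_def AF fib_def llp_def rlp_def by auto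
    \<comment> \<open>This is the retract argument. The second factor of an
      \<open>AC\<close>-\<open>fib\<close> factorization is a weak equivalence by two-out-of-three,
      so the given cofibration lifts against it and its target is isomorphic to the middle
      object.\<close>
    show "cof \<inter> we \<subseteq> AC"
    proof safe
      fix x y assume cof: "(x, y) \<in> cof" and we: "(x, y) \<in> we"
      then have xy: "x \<sqsubseteq> y" by (simp add: we_def)
      then obtain w where w: "(x, w) \<in> AC" "(w, y) \<in> fib"
        using wfs1 unfolding weak_factorization_system_def wfs_factorization_iff by blast
      then have le: "x \<sqsubseteq> w" "w \<sqsubseteq> y" by (auto simp: AC fib_def rlp_iff)
      have "(w, y) \<in> we"
        using two3 w(1) AC_we we le unfolding two_out_of_three_iff by blast
      with w have "(w, y) \<in> AF" by (simp add: AF)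
      with cof le r_subset refl have "y \<sqsubseteq> w" by (auto simp: cof_def llp_iff)
      moreover have "isomorphic_in r x x" using r_subset[OF xy] refl by (simp add: isomorphic_in_def)
      ultimately show "(x, y) \<in> AC"
        using w(1) le AC_retract unfolding retract_closed_iff[OF AC_sub] isomorphic_in_def by blast
    qed
  qed
  have we_sub: "we \<subseteq> r" by (auto simp: we_def)
  have "\<forall>x\<in>A. (x, x) \<in> we" by (simp add: we_def refl)
  moreover have "(x, z) \<in> we" if "(x, y) \<in> we" "(y, z) \<in> we" for x y z
    using that trans[of x y z] trans[of "\<rho> (\<kappa> z)" "\<rho> (\<kappa> y)" "\<rho> (\<kappa> x)"] by (simp add: we_def)
  ultimately have "wide_subcategory K we"
    unfolding wide_subcategory_iff using we_sub by blast
  moreover have "retract_closed K we"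
    unfolding retract_closed_iff[OF we_sub]
  proof (intro allI impI)
    fix x y u v assume uv: "(u, v) \<in> we" and iso: "isomorphic_in r x u" "isomorphic_in r y v"
    then have "x \<sqsubseteq> y" using trans unfolding we_def isomorphic_in_def by blast
    moreover have "\<rho> (\<kappa> y) \<sqsubseteq> \<rho> (\<kappa> v)" "\<rho> (\<kappa> v) \<sqsubseteq> \<rho> (\<kappa> u)" "\<rho> (\<kappa> u) \<sqsubseteq> \<rho> (\<kappa> x)"
      using uv iso Q_mono unfolding we_def isomorphic_in_def by blast+
    ultimately show "(x, y) \<in> we" using trans unfolding we_def by blast
  qed
  ultimately have "model_structure K cof we fib"
    unfolding model_structure_def AC_eq using wfs1 wfs2 two3 llp_subcategory rlp_subcategory
    by (simp add: cof_def fib_def)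
  moreover have "fibrant_objects K fib = F"
  proof safe
    fix x assume "x \<in> F"
    then show "x \<in> fibrant_objects K fib"
      using fib_F t F_subset unfolding fibrant_objects_iff is_terminal_iff by blast
  next
    fix x assume "x \<in> fibrant_objects K fib"
    then obtain u where x: "x \<in> A" and u: "\<forall>y\<in>A. y \<sqsubseteq> u" "(x, u) \<in> fib"
      unfolding fibrant_objects_iff is_terminal_iff by blast
    \<comment> \<open>Lift \<open>x \<sqsubseteq> \<rho> x\<close> against the fibration
      \<open>x \<sqsubseteq> u\<close>, with the identity of \<open>x\<close> on top.\<close>
    from u(2) AC_reflection[OF x] u(1) x refl have "\<rho> x \<sqsubseteq> x"
      by (auto simp: fib_def rlp_iff)
    then show "x \<in> F" by (rule in_F)
  qed
  moreover have "cofibrant_objects K cof = C"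
  proof safe
    fix c assume c: "c \<in> C"
    have "c \<sqsubseteq> x" if "(x, y) \<in> AF" "b \<sqsubseteq> x" "c \<sqsubseteq> y" for x y
      using that c unfolding AF_def rlp_iff by blast
    moreover have "b \<sqsubseteq> c" using b C_subset c by blast
    ultimately have "(b, c) \<in> cof" unfolding cof_def llp_iff by blast
    with c b C_subset show "c \<in> cofibrant_objects K cof"
      unfolding cofibrant_objects_iff is_initial_iff by blast
  next
    fix x assume "x \<in> cofibrant_objects K cof"
    then obtain i where x: "x \<in> A" and i: "\<forall>y\<in>A. i \<sqsubseteq> y" "(i, x) \<in> cof"
      unfolding cofibrant_objects_iff is_initial_iff by blast
    have "\<kappa> x \<sqsubseteq> \<kappa> (\<kappa> x)" using refl x le_coreflection coreflection_in by blast
    \<comment> \<open>The coreflection map is an acyclic fibration, since every member of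
      \<open>C\<close> below \<open>x\<close> is below \<open>\<kappa> x\<close>. The cofibration
      \<open>i \<sqsubseteq> x\<close> then lifts against it.\<close>
    then have "(\<kappa> x, x) \<in> AF"
      using fib_coreflection[OF x] coreflection_le[OF x] le_coreflection[of _ x]
      by (auto simp: AF_def fib_def rlp_iff)
    with i x refl have "x \<sqsubseteq> \<kappa> x" by (auto simp: cof_def llp_iff)
    then show "x \<in> C" by (rule in_C)
  qed
  ultimately show ?thesis by blast
qed

end

section \<open>Model structures on a bicomplete preorder\<close>

locale preorder_model = bicomplete_preorder +
  fixes cof we fib
  assumes model: "model_structure K cof we fib"
begin

abbreviation F where "F \<equiv> fibrant_objects K fib"
abbreviation C where "C \<equiv> cofibrant_objects K cof"

section \<open>Order-theoretic form of the model axioms\<close>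

lemma classes_subset: "cof \<subseteq> r" "we \<subseteq> r" "fib \<subseteq> r"
  using model unfolding model_structure_def wide_subcategory_def preorder_cat_simps by blast+

lemma compose:
  "(x, y) \<in> cof \<Longrightarrow> (y, z) \<in> cof \<Longrightarrow> (x, z) \<in> cof"
  "(x, y) \<in> we \<Longrightarrow> (y, z) \<in> we \<Longrightarrow> (x, z) \<in> we"
  "(x, y) \<in> fib \<Longrightarrow> (y, z) \<in> fib \<Longrightarrow> (x, z) \<in> fib"
proof -
  have "wide_subcategory K cof" "wide_subcategory K we" "wide_subcategory K fib"
    using model unfolding model_structure_def by blast+
  then show "(x, y) \<in> cof \<Longrightarrow> (y, z) \<in> cof \<Longrightarrow> (x, z) \<in> cof"
    "(x, y) \<in> we \<Longrightarrow> (y, z) \<in> we \<Longrightarrow> (x, z) \<in> we"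
    "(x, y) \<in> fib \<Longrightarrow> (y, z) \<in> fib \<Longrightarrow> (x, z) \<in> fib"
    unfolding wide_subcategory_iff by blast+
qed

lemma iso_invariant:
  assumes "isomorphic_in r x u" "isomorphic_in r y v"
  shows "(u, v) \<in> cof \<Longrightarrow> (x, y) \<in> cof" "(u, v) \<in> fib \<Longrightarrow> (x, y) \<in> fib"
proof -
  have "retract_closed K cof" "retract_closed K fib"
    using model unfolding model_structure_def by blast+
  then show "(u, v) \<in> cof \<Longrightarrow> (x, y) \<in> cof" "(u, v) \<in> fib \<Longrightarrow> (x, y) \<in> fib"
    using assms unfolding retract_closed_iff[OF classes_subset(1)] retract_closed_iff[OF classes_subset(3)]
    by blast+
qed

lemma two_of_three:
  "(x, y) \<in> we \<Longrightarrow> (x, z) \<in> we \<Longrightarrow> y \<sqsubseteq> z \<Longrightarrow> (y, z) \<in> we"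
  "(y, z) \<in> we \<Longrightarrow> (x, z) \<in> we \<Longrightarrow> x \<sqsubseteq> y \<Longrightarrow> (x, y) \<in> we"
proof -
  have *: "two_out_of_three K we" using model unfolding model_structure_def by blast
  show "(x, y) \<in> we \<Longrightarrow> (x, z) \<in> we \<Longrightarrow> y \<sqsubseteq> z \<Longrightarrow> (y, z) \<in> we"
    "(y, z) \<in> we \<Longrightarrow> (x, z) \<in> we \<Longrightarrow> x \<sqsubseteq> y \<Longrightarrow> (x, y) \<in> we"
    using *[unfolded two_out_of_three_iff, rule_format, of x y z] classes_subset(2) by blast+
qed

lemma factorization:
  assumes "x \<sqsubseteq> y"
  shows "\<exists>w. (x, w) \<in> cof \<inter> we \<and> (w, y) \<in> fib" "\<exists>w. (x, w) \<in> cof \<and> (w, y) \<in> we \<inter> fib"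
proof -
  have "weak_factorization_system K (cof \<inter> we) fib" "weak_factorization_system K cof (we \<inter> fib)"
    using model unfolding model_structure_def by blast+
  then show "\<exists>w. (x, w) \<in> cof \<inter> we \<and> (w, y) \<in> fib" "\<exists>w. (x, w) \<in> cof \<and> (w, y) \<in> we \<inter> fib"
    using assms unfolding weak_factorization_system_def wfs_factorization_iff by blast+
qed

text \<open>The disjunction covers the lifting axioms of both weak factorization systems at
  once.\<close>

lemma lift:
  assumes "(a, b) \<in> cof" "(x, y) \<in> fib" "(a, b) \<in> we \<or> (x, y) \<in> we" "a \<sqsubseteq> x" "b \<sqsubseteq> y"
  shows "b \<sqsubseteq> x"
proof -
  have "cof \<inter> we = llp K fib"
    using model unfolding model_structure_def weak_factorization_system_def by (elim conjE)
  moreover have "cof = llp K (we \<inter> fib)"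
    using model unfolding model_structure_def weak_factorization_system_def by (elim conjE)
  ultimately have "lifts K (a, b) (x, y)" using assms(1-3) unfolding llp_def by blast
  with assms(4,5) show ?thesis by (simp add: lifts_iff)
qed

text \<open>Lift against the fibration from \<open>f\<close> to a terminal object. This extension
  property makes fibrant replacement a reflection; \<open>lift_cofibrant\<close> is the
  dual.\<close>

lemma lift_fibrant:
  assumes "(a, b) \<in> cof" "(a, b) \<in> we" "a \<sqsubseteq> f" "f \<in> F"
  shows "b \<sqsubseteq> f"
proof -
  obtain t where t: "is_terminal K t" "(f, t) \<in> fib" using assms(4) fibrant_objects_iff by blast
  have "b \<sqsubseteq> t" using t(1) r_subset[of a b] assms(1) classes_subset(1) unfolding is_terminal_iff by blast
  with assms t(2) show ?thesis by (blast intro: lift)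
qed

lemma lift_cofibrant:
  assumes "(x, y) \<in> fib" "(x, y) \<in> we" "c \<sqsubseteq> y" "c \<in> C"
  shows "c \<sqsubseteq> x"
proof -
  obtain i where i: "is_initial K i" "(i, c) \<in> cof" using assms(4) cofibrant_objects_iff by blast
  have "i \<sqsubseteq> x" using i(1) r_subset[of x y] assms(2) classes_subset(2) unfolding is_initial_iff by blast
  with assms i(2) show ?thesis by (blast intro: lift)
qed

lemma fibrant_domain: "(x, y) \<in> fib \<Longrightarrow> y \<in> F \<Longrightarrow> x \<in> F"
  unfolding fibrant_objects_iff using classes_subset(3) r_subset[of x y] compose(3) by blast

lemma cofibrant_codomain: "(x, y) \<in> cof \<Longrightarrow> x \<in> C \<Longrightarrow> y \<in> C"
  unfolding cofibrant_objects_iff using classes_subset(1) r_subset[of x y] compose(1) by blast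

text \<open>Isomorphic objects have maps to the terminal object that are retracts of each
  other.\<close>

lemma iso_closed_fibrant: "iso_closed A r F"
  unfolding iso_closed_def
proof (intro ballI impI)
  fix x y assume x: "x \<in> F" and y: "y \<in> A" and iso: "isomorphic_in r x y"
  obtain t where t: "is_terminal K t" "(x, t) \<in> fib" using x by (auto simp: fibrant_objects_iff)
  have "isomorphic_in r y x" "isomorphic_in r t t"
    using iso t(1) by (auto simp: isomorphic_in_def is_terminal_iff refl)
  with t y show "y \<in> F" using iso_invariant(2) fibrant_objects_iff by blast
qed

lemma iso_closed_cofibrant: "iso_closed A r C"
  unfolding iso_closed_def
proof (intro ballI impI)
  fix x y assume x: "x \<in> C" and y: "y \<in> A" and iso: "isomorphic_in r x y"
  obtain i where i: "is_initial K i" "(i, x) \<in> cof" using x by (auto simp: cofibrant_objects_iff)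
  have "isomorphic_in r y x" "isomorphic_in r i i"
    using iso i(1) by (auto simp: isomorphic_in_def is_initial_iff refl)
  with i y show "y \<in> C" using iso_invariant(1) cofibrant_objects_iff by blast
qed

section \<open>Replacements and the Whitehead property\<close>

lemma fibrant_replacement: "x \<in> A \<Longrightarrow> \<exists>w. w \<in> F \<and> (x, w) \<in> cof \<inter> we"
proof -
  assume x: "x \<in> A"
  obtain t where t: "\<And>x. x \<in> A \<Longrightarrow> x \<sqsubseteq> t" "t \<in> A" using obtain_top by blast
  obtain w where w: "(x, w) \<in> cof \<inter> we" "(w, t) \<in> fib" using factorization(1)[OF t(1)[OF x]] by blast
  then have "w \<in> F"
    using t r_subset[of w t] classes_subset(3) unfolding fibrant_objects_iff is_terminal_iff by blast
  with w show ?thesis by blast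
qed

lemma cofibrant_replacement: "x \<in> A \<Longrightarrow> \<exists>w. w \<in> C \<and> (w, x) \<in> we \<inter> fib"
proof -
  assume x: "x \<in> A"
  obtain i where i: "\<And>x. x \<in> A \<Longrightarrow> i \<sqsubseteq> x" "i \<in> A" using obtain_bot by blast
  obtain w where w: "(i, w) \<in> cof" "(w, x) \<in> we \<inter> fib" using factorization(2)[OF i(1)[OF x]] by blast
  then have "w \<in> C"
    using i r_subset[of i w] classes_subset(1) unfolding cofibrant_objects_iff is_initial_iff by blast
  with w show ?thesis by blast
qed

lemma ex_replacements:
  obtains \<rho> \<kappa> where "\<And>x. x \<in> A \<Longrightarrow> \<rho> x \<in> F \<and> (x, \<rho> x) \<in> cof \<inter> we"
    "\<And>x. x \<in> A \<Longrightarrow> \<kappa> x \<in> C \<and> (\<kappa> x, x) \<in> we \<inter> fib"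
  using fibrant_replacement cofibrant_replacement by metis

text \<open>Factor the map through \<open>w\<close> as an acyclic cofibration and a fibration, which
  is acyclic by two-out-of-three. Cofibrancy of \<open>y\<close> lifts its identity to
  \<open>y \<sqsubseteq> w\<close>, and fibrancy of \<open>x\<close> extends its identity to
  \<open>w \<sqsubseteq> x\<close>.\<close>

lemma whitehead:
  assumes "(x, y) \<in> we" "x \<in> F" "y \<in> C"
  shows "y \<sqsubseteq> x"
proof -
  obtain w where w: "(x, w) \<in> cof \<inter> we" "(w, y) \<in> fib"
    using factorization(1) assms(1) classes_subset by blast
  have "(w, y) \<in> we" using two_of_three(1) w assms(1) classes_subset by blast
  then have "y \<sqsubseteq> w"
    using lift_cofibrant[of w y y] w assms classes_subset refl r_subset by blast
  moreover have "w \<sqsubseteq> x"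
    using lift_fibrant[of x w x] w assms classes_subset refl r_subset by blast
  ultimately show ?thesis by (rule trans)
qed

end

locale preorder_model_replacements = preorder_model +
  fixes \<rho> \<kappa> :: "'a \<Rightarrow> 'a"
  assumes fibrant_repl: "\<And>x. x \<in> A \<Longrightarrow> \<rho> x \<in> F \<and> (x, \<rho> x) \<in> cof \<inter> we"
    and cofibrant_repl: "\<And>x. x \<in> A \<Longrightarrow> \<kappa> x \<in> C \<and> (\<kappa> x, x) \<in> we \<inter> fib"
begin

text \<open>Maps to fibrant objects extend along \<open>x \<sqsubseteq> \<rho> x\<close>, and maps
  from cofibrant objects lift through \<open>\<kappa> x \<sqsubseteq> x\<close>.\<close>

sublocale reflection_pair A r F C \<rho> \<kappa>
proof
  show "F \<subseteq> A" "C \<subseteq> A" by (auto simp: fibrant_objects_iff cofibrant_objects_iff)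
  show "is_least r (upper_bounds_in r F x) (\<rho> x)" if "x \<in> A" for x
    using fibrant_repl[OF that] classes_subset lift_fibrant
    by (auto simp: is_least_def upper_bounds_in_def)
  show "is_greatest r (lower_bounds_in r C x) (\<kappa> x)" if "x \<in> A" for x
    using cofibrant_repl[OF that] classes_subset lift_cofibrant
    by (auto simp: is_greatest_def lower_bounds_in_def)
qed

text \<open>A cofibration out of \<open>\<kappa> x\<close> keeps its target cofibrant, and a
  fibration to \<open>\<rho> x\<close> keeps its source fibrant.\<close>

lemma bifibrant:
  assumes "x \<in> A"
  shows "\<rho> (\<kappa> x) \<in> F \<inter> C" "\<kappa> (\<rho> x) \<in> F \<inter> C"
  using fibrant_repl cofibrant_repl cofibrant_codomain fibrant_domain assms
    in_A[OF assms] by (meson IntE IntI)+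

text \<open>The inequalities form a square from the acyclic cofibration
  \<open>x \<sqsubseteq> \<rho> x\<close> to the fibration
  \<open>\<kappa> y \<sqsubseteq> y\<close>.\<close>

lemma interpolation:
  assumes "x \<in> A" "y \<in> A" "x \<sqsubseteq> \<kappa> y" "\<rho> x \<sqsubseteq> y"
  shows "\<rho> x \<sqsubseteq> \<kappa> y"
  using lift[of x "\<rho> x" "\<kappa> y" y] fibrant_repl[OF assms(1)] cofibrant_repl[OF assms(2)] assms(3,4)
  by blast

text \<open>The universal properties give
  \<open>\<rho> (\<kappa> x) \<sqsubseteq> \<kappa> (\<rho> x)\<close>. By two-out-of-three this
  comparison is a weak equivalence between bifibrant objects, so \<open>whitehead\<close> reverses
  it.\<close>

lemma commute:
  assumes x: "x \<in> A"
  shows "isomorphic_in r (\<rho> (\<kappa> x)) (\<kappa> (\<rho> x))"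
proof -
  note A = x in_A[OF x] in_A(1)[OF in_A(2)[OF x]]
  have le: "\<kappa> x \<sqsubseteq> \<rho> x" using coreflection_le[OF x] le_reflection[OF x] trans by blast
  have "\<rho> (\<kappa> x) \<sqsubseteq> \<rho> x" using reflection_le[OF le] fibrant_repl[OF x] by blast
  then have fwd: "\<rho> (\<kappa> x) \<sqsubseteq> \<kappa> (\<rho> x)" using bifibrant(1)[OF x] le_coreflection by blast
  have "(\<kappa> x, \<rho> x) \<in> we" using fibrant_repl[OF x] cofibrant_repl[OF x] compose(2) by blast
  moreover have "\<kappa> x \<sqsubseteq> \<kappa> (\<rho> x)" using le_coreflection[OF le] cofibrant_repl[OF x] by blast
  ultimately have "(\<kappa> x, \<kappa> (\<rho> x)) \<in> we"
    using two_of_three(2) cofibrant_repl[OF A(2)] by blast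
  then have "(\<rho> (\<kappa> x), \<kappa> (\<rho> x)) \<in> we"
    using two_of_three(1) fibrant_repl[OF A(3)] fwd by blast
  then have "\<kappa> (\<rho> x) \<sqsubseteq> \<rho> (\<kappa> x)" using whitehead bifibrant[OF x] by blast
  with fwd show ?thesis by (simp add: isomorphic_in_def)
qed

end

section \<open>The homotopy category\<close>

context preorder_model_replacements
begin

abbreviation Q where "Q x \<equiv> \<rho> (\<kappa> x)"
abbreviation B where "B \<equiv> F \<inter> C"
abbreviation KB where "KB \<equiv> preorder_cat B (Restr r B)"
abbreviation H where "H \<equiv> localization K we"
abbreviation \<gamma> where "\<gamma> \<equiv> localization_functor K we"

section \<open>Bifibrant replacement as a functor\<close>

lemma Q_mono: "x \<sqsubseteq> y \<Longrightarrow> Q x \<sqsubseteq> Q y"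
  by (intro reflection_mono coreflection_mono)

text \<open>Two-out-of-three carries the weak equivalence first to
  \<open>\<kappa> x \<sqsubseteq> \<kappa> y\<close> and then to
  \<open>Q x \<sqsubseteq> Q y\<close>, where \<open>whitehead\<close> applies.\<close>

lemma Q_iso:
  assumes "(x, y) \<in> we"
  shows "Q y \<sqsubseteq> Q x"
proof -
  have xy: "x \<sqsubseteq> y" using assms classes_subset by blast
  then have A: "x \<in> A" "y \<in> A" using r_subset by auto
  have "(\<kappa> x, y) \<in> we" using assms cofibrant_repl[OF A(1)] compose(2) by blast
  then have "(\<kappa> x, \<kappa> y) \<in> we"
    using cofibrant_repl[OF A(2)] two_of_three(2) coreflection_mono[OF xy] by blast
  then have "(\<kappa> x, Q y) \<in> we" using fibrant_repl[OF in_A(2)[OF A(2)]] compose(2) by blast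
  then have "(Q x, Q y) \<in> we"
    using fibrant_repl[OF in_A(2)[OF A(1)]] two_of_three(1) Q_mono[OF xy] by blast
  then show ?thesis using whitehead bifibrant(1) A by blast
qed

lemma Q_bifibrant: "x \<in> B \<Longrightarrow> isomorphic_in r x (Q x)"
proof -
  assume x: "x \<in> B"
  then have A: "x \<in> A" by (simp add: fibrant_objects_iff)
  have "x \<sqsubseteq> \<kappa> x" using x refl[OF A] by (intro le_coreflection) auto
  moreover have "\<kappa> x \<sqsubseteq> Q x" using A by (intro le_reflection) auto
  moreover have "Q x \<sqsubseteq> x" using x coreflection_le[OF A] by (intro reflection_le) auto
  ultimately show ?thesis using trans unfolding isomorphic_in_def by blast
qed

lemma category_KB: "category KB"
proof (rule category_preorder_cat)
  have "refl_on B (Restr r B)" using refl by (auto simp: refl_on_def fibrant_objects_iff)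
  moreover have "Relation.trans (Restr r B)" using trans by (intro transI) blast
  ultimately show "preorder_on B (Restr r B)" by (auto simp: preorder_on_def)
qed

lemma is_iso_KB: "x \<sqsubseteq> y \<Longrightarrow> y \<sqsubseteq> x \<Longrightarrow> x \<in> B \<Longrightarrow> y \<in> B \<Longrightarrow> is_iso KB (x, y)"
  by (simp add: is_iso_def Hom_preorder_cat)

lemma functor_inclusion: "functor_between KB K inclusion_functor"
proof -
  interpret KB: category KB by (rule category_KB)
  show ?thesis
    by unfold_locales
      (auto simp: inclusion_functor_def id_functor_def Hom_preorder_cat fibrant_objects_iff
        split: if_splits)
qed

lemma functor_Q: "functor_between K KB \<lparr>OMap = Q, AMap = map_prod Q Q\<rparr>"
proof -
  interpret KB: category KB by (rule category_KB)
  show ?thesis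
    by unfold_locales
      (use bifibrant(1) Q_mono in \<open>auto simp: Hom_preorder_cat dest: r_subset split: if_splits\<close>)
qed

text \<open>Arrows of \<open>H\<close> are classes of zigzags, and \<open>H\<close> is not yet known
  to be a preorder, so equations between its arrows have to be derived from functoriality.\<close>

lemma localization_arr:
  assumes "x \<sqsubseteq> y"
  shows "AMap \<gamma> (x, y) \<in> Hom H x y"
    and "y \<sqsubseteq> z \<Longrightarrow> Comp H (AMap \<gamma> (y, z)) (AMap \<gamma> (x, y)) = AMap \<gamma> (x, z)"
    and "(x, y) \<in> we \<Longrightarrow> is_iso H (AMap \<gamma> (x, y))"
proof -
  interpret \<gamma>: functor_between K H \<gamma> by (rule functor_localization)
  have xy: "(x, y) \<in> Hom K x y" using assms by (simp add: Hom_preorder_cat)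
  from \<gamma>.AMap_Hom[OF this] show "AMap \<gamma> (x, y) \<in> Hom H x y"
    by (simp add: localization_functor_def)
  show "Comp H (AMap \<gamma> (y, z)) (AMap \<gamma> (x, y)) = AMap \<gamma> (x, z)" if "y \<sqsubseteq> z"
  proof -
    have "(y, z) \<in> Hom K y z" using that by (simp add: Hom_preorder_cat)
    from \<gamma>.AMap_Comp[OF xy this] show ?thesis by simp
  qed
  show "is_iso H (AMap \<gamma> (x, y))" if "(x, y) \<in> we"
    using that assms by (intro localization_inverts) auto
qed

text \<open>The component at \<open>x\<close> of the counit: go from \<open>Q x\<close> back to
  \<open>\<kappa> x\<close> by an inverse in the localization, then forward to
  \<open>x\<close>.\<close>

definition zigzag_to :: "'a \<Rightarrow> 'a \<times> ('a \<times> 'a) step list set \<times> 'a" where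
  "zigzag_to x = Comp H (AMap \<gamma> (\<kappa> x, x)) (inverse_arr H (AMap \<gamma> (\<kappa> x, Q x)))"

lemma replacement_we:
  assumes "x \<in> A"
  shows "(\<kappa> x, x) \<in> we" "(\<kappa> x, Q x) \<in> we" "\<kappa> x \<sqsubseteq> x" "\<kappa> x \<sqsubseteq> Q x"
  using assms cofibrant_repl fibrant_repl in_A(2) classes_subset(2) by blast+

lemma zigzag_to:
  assumes x: "x \<in> A"
  shows "zigzag_to x \<in> Hom H (Q x) x" "is_iso H (zigzag_to x)"
proof -
  interpret H: category H by (rule category_localization)
  note k = replacement_we[OF x]
  note u = localization_arr(1)[OF k(4)] localization_arr(3)[OF k(4,2)]
  note p = localization_arr(1)[OF k(3)] localization_arr(3)[OF k(3,1)]
  note v = inverse_arr(1)[OF u(2,1)] H.is_iso_inverse_arr[OF u]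
  show "zigzag_to x \<in> Hom H (Q x) x"
    unfolding zigzag_to_def by (rule H.Comp_Hom[OF v(1) p(1)])
  show "is_iso H (zigzag_to x)"
    unfolding zigzag_to_def by (rule H.is_iso_Comp[OF v(1) p(1) v(2) p(2)])
qed

text \<open>Paste two squares over \<open>\<kappa> x \<sqsubseteq> \<kappa> y\<close>: the one to
  \<open>x \<sqsubseteq> y\<close>, and the one to \<open>Q x \<sqsubseteq> Q y\<close> reversed by
  \<open>inverse_arr_natural\<close>.\<close>

lemma zigzag_to_natural:
  assumes xy: "x \<sqsubseteq> y"
  shows "Comp H (zigzag_to y) (AMap \<gamma> (Q x, Q y)) = Comp H (AMap \<gamma> (x, y)) (zigzag_to x)"
proof -
  interpret H: category H by (rule category_localization)
  have A: "x \<in> A" "y \<in> A" using r_subset[OF xy] by auto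
  note kx = replacement_we[OF A(1)] and ky = replacement_we[OF A(2)]
  note m = coreflection_mono[OF xy] Q_mono[OF xy]
  note u = localization_arr(1)[OF kx(4)] localization_arr(3)[OF kx(4,2)]
  note u' = localization_arr(1)[OF ky(4)] localization_arr(3)[OF ky(4,2)]
  note p = localization_arr(1)[OF kx(3)] and p' = localization_arr(1)[OF ky(3)]
  note v = inverse_arr(1)[OF u(2,1)] and v' = inverse_arr(1)[OF u'(2,1)]
  note a = localization_arr(1)[OF m(2)] and b = localization_arr(1)[OF m(1)]
  have "Comp H (AMap \<gamma> (Q x, Q y)) (AMap \<gamma> (\<kappa> x, Q x))
      = Comp H (AMap \<gamma> (\<kappa> y, Q y)) (AMap \<gamma> (\<kappa> x, \<kappa> y))"
    using localization_arr(2)[OF kx(4) m(2)] localization_arr(2)[OF m(1) ky(4)] by simp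
  note inv = H.inverse_arr_natural[OF u u' a b this]
  have "Comp H (AMap \<gamma> (\<kappa> y, y)) (AMap \<gamma> (\<kappa> x, \<kappa> y)) = Comp H (AMap \<gamma> (x, y)) (AMap \<gamma> (\<kappa> x, x))"
    using localization_arr(2)[OF m(1) ky(3)] localization_arr(2)[OF kx(3) xy] by simp
  then show ?thesis
    unfolding zigzag_to_def
    using H.Comp_assoc[OF a v' p'] inv H.Comp_assoc[OF v b p']
      H.Comp_assoc[OF v p localization_arr(1)[OF xy]] by simp
qed

text \<open>Since \<open>Q\<close> turns weak equivalences into isomorphisms, it extends to a
  functor \<open>\<Psi>\<close> on the localization. The unit consists of the isomorphisms between
  bifibrant \<open>x\<close> and \<open>Q x\<close>, the counit of the arrows
  \<open>zigzag_to x\<close>.\<close>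

lemma homotopy_category: "is_equivalence KB H (comp_functor \<gamma> inclusion_functor)"
proof -
  let ?Q = "\<lparr>OMap = Q, AMap = map_prod Q Q\<rparr>" and ?I = "comp_functor \<gamma> inclusion_functor"
  have I: "functor_between KB H ?I"
    by (rule functor_between_comp[OF functor_inclusion functor_localization])
  have W: "\<forall>w \<in> we. is_iso KB (AMap ?Q w)"
  proof
    fix w assume w: "w \<in> we"
    obtain x y where xy: "w = (x, y)" by fastforce
    then have le: "x \<sqsubseteq> y" using w classes_subset(2) by blast
    then show "is_iso KB (AMap ?Q w)"
      using w xy Q_mono Q_iso bifibrant(1) r_subset[OF le] by (simp add: is_iso_KB)
  qed
  obtain \<Psi> where \<Psi>: "functor_between H KB \<Psi>"
    and O: "\<forall>x \<in> Obj K. OMap (comp_functor \<Psi> \<gamma>) x = OMap ?Q x"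
    and M: "\<forall>f \<in> Arr K. AMap (comp_functor \<Psi> \<gamma>) f = AMap ?Q f"
    using functor_between.localization_extension[OF functor_Q W] by blast
  have \<Psi>_obj: "OMap \<Psi> x = Q x" if "x \<in> A" for x
    using O that by (simp add: comp_functor_def localization_functor_def)
  have \<Psi>_arr: "AMap \<Psi> (AMap \<gamma> (x, y)) = (Q x, Q y)" if "x \<sqsubseteq> y" for x y
    using M that by (simp add: comp_functor_def)
  have \<eta>: "natural_iso KB KB id_functor (comp_functor \<Psi> ?I) (\<lambda>x. (x, Q x))"
    unfolding natural_iso_def
  proof (intro conjI ballI)
    fix x assume "x \<in> Obj KB"
    then have x: "x \<in> B" by simp
    then have "x \<in> A" by (simp add: fibrant_objects_iff)
    with x Q_bifibrant[OF x] bifibrant(1)[of x] have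
      *: "x \<in> A" "x \<sqsubseteq> Q x" "Q x \<sqsubseteq> x" "Q x \<in> B" unfolding isomorphic_in_def by blast+
    then show "is_iso KB (x, Q x)" using x by (intro is_iso_KB)
    have "OMap (comp_functor \<Psi> ?I) x = Q x"
      using \<Psi>_obj[OF *(1)]
      by (simp add: comp_functor_def localization_functor_def inclusion_functor_def id_functor_def)
    then show "(x, Q x) \<in> Hom KB (OMap id_functor x) (OMap (comp_functor \<Psi> ?I) x)"
      using x * by (simp add: Hom_preorder_cat id_functor_def)
  next
    fix f assume "f \<in> Arr KB"
    then obtain x y where "f = (x, y)" "x \<sqsubseteq> y" by auto
    then show "Comp KB (Cod KB f, Q (Cod KB f)) (AMap id_functor f)
        = Comp KB (AMap (comp_functor \<Psi> ?I) f) (Dom KB f, Q (Dom KB f))"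
      using \<Psi>_arr[of x y]
      by (simp add: comp_functor_def inclusion_functor_def id_functor_def)
  qed
  let ?id = "id_functor :: ('a, 'a \<times> ('a \<times> 'a) step list set \<times> 'a, 'a, _) fctr"
  have natural: "Comp H (zigzag_to y) (AMap (comp_functor ?I \<Psi>) g)
      = Comp H (AMap ?id g) (zigzag_to x)" if g: "g \<in> Hom H x y" for g x y
  \<comment> \<open>Naturality against arbitrary zigzags reduces to arrows of \<open>K\<close>,
    where \<open>zigzag_to_natural\<close> applies.\<close>
  proof (rule natural_on_localization[OF category_axioms _ _ _ _ g])
    show "functor_between H H (comp_functor ?I \<Psi>)" by (rule functor_between_comp[OF \<Psi> I])
    show "functor_between H H ?id" by (rule functor_between_id[OF category_localization])
    show "zigzag_to x \<in> Hom H (OMap (comp_functor ?I \<Psi>) x) (OMap ?id x)" if "x \<in> Obj K" for x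
      using zigzag_to(1)[of x] \<Psi>_obj[of x] that
      by (simp add: comp_functor_def localization_functor_def inclusion_functor_def id_functor_def)
    show "Comp H (zigzag_to y) (AMap (comp_functor ?I \<Psi>) (AMap \<gamma> f))
        = Comp H (AMap ?id (AMap \<gamma> f)) (zigzag_to x)" if "f \<in> Hom K x y" for f x y
    proof -
      from that have xy: "f = (x, y)" "x \<sqsubseteq> y" by (auto simp: Hom_preorder_cat split: if_splits)
      have "AMap (comp_functor ?I \<Psi>) (AMap \<gamma> f) = AMap \<gamma> (Q x, Q y)"
        using \<Psi>_arr[OF xy(2)] xy(1) by (simp add: comp_functor_def inclusion_functor_def id_functor_def)
      then show ?thesis using zigzag_to_natural[OF xy(2)] xy(1) by (simp add: id_functor_def)
    qed
  qed
  have "natural_iso H H (comp_functor ?I \<Psi>) ?id zigzag_to"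
    unfolding natural_iso_def
  proof (intro conjI ballI)
    fix x assume "x \<in> Obj H"
    then have x: "x \<in> A" by (simp add: localization_def)
    then show "is_iso H (zigzag_to x)" by (rule zigzag_to)
    show "zigzag_to x \<in> Hom H (OMap (comp_functor ?I \<Psi>) x) (OMap ?id x)"
      using zigzag_to(1)[OF x] \<Psi>_obj[OF x]
      by (simp add: comp_functor_def localization_functor_def inclusion_functor_def id_functor_def)
  next
    fix f assume "f \<in> Arr H"
    then show "Comp H (zigzag_to (Cod H f)) (AMap (comp_functor ?I \<Psi>) f)
        = Comp H (AMap ?id f) (zigzag_to (Dom H f))"
      by (intro natural) (simp add: Hom_def)
  qed
  with I \<Psi> \<eta> show ?thesis unfolding is_equivalence_def by blast
qed

end

section \<open>Equivalence of the conditions with existence, and the homotopy category\<close>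

theorem corollary2:
  fixes A F C :: "'a set" and r :: "'a rel"
  assumes "preorder_on A r" and "bicomplete A r" and "F \<subseteq> A" and "C \<subseteq> A"
  shows "((\<exists>cof we fib. model_structure (preorder_cat A r) cof we fib \<and>
              fibrant_objects (preorder_cat A r) fib = F \<and>
              cofibrant_objects (preorder_cat A r) cof = C) \<longleftrightarrow>
            (iso_closed A r F \<and> iso_closed A r C) \<and>
            reflective A r F \<and>
            coreflective A r C \<and>
            (\<forall>x\<in>A. \<forall>f\<in>F. \<forall>c\<in>C.
               is_minimal r {g \<in> F. \<forall>l \<in> lower_bounds_in r C x. (l, g) \<in> r} f \<and>
               is_maximal r {d \<in> C. \<forall>u \<in> upper_bounds_in r F x. (d, u) \<in> r} c \<longrightarrow>
               isomorphic_in r f c) \<and>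
            (\<forall>x\<in>A. \<forall>y\<in>A.
               (\<exists>l \<in> lower_bounds_in r C y. (x, l) \<in> r) \<and>
               (\<exists>u \<in> upper_bounds_in r F x. (u, y) \<in> r) \<longrightarrow>
               (\<exists>u \<in> upper_bounds_in r F x. \<exists>l \<in> lower_bounds_in r C y. (u, l) \<in> r)))
         \<and> (\<forall>cof we fib. model_structure (preorder_cat A r) cof we fib \<and>
              fibrant_objects (preorder_cat A r) fib = F \<and>
              cofibrant_objects (preorder_cat A r) cof = C \<longrightarrow>
            is_equivalence (preorder_cat (F \<inter> C) (Restr r (F \<inter> C)))
              (localization (preorder_cat A r) we)
              (comp_functor (localization_functor (preorder_cat A r) we) inclusion_functor))"
proof -
  interpret bicomplete_preorder A r by standard (fact assms)+
  let ?four = "\<forall>x\<in>A. \<forall>f\<in>F. \<forall>c\<in>C.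
      is_minimal r {g \<in> F. \<forall>l \<in> lower_bounds_in r C x. (l, g) \<in> r} f \<and>
      is_maximal r {d \<in> C. \<forall>u \<in> upper_bounds_in r F x. (d, u) \<in> r} c \<longrightarrow>
      isomorphic_in r f c"
  let ?five = "\<forall>x\<in>A. \<forall>y\<in>A.
      (\<exists>l \<in> lower_bounds_in r C y. (x, l) \<in> r) \<and>
      (\<exists>u \<in> upper_bounds_in r F x. (u, y) \<in> r) \<longrightarrow>
      (\<exists>u \<in> upper_bounds_in r F x. \<exists>l \<in> lower_bounds_in r C y. (u, l) \<in> r)"
  let ?conditions = "(iso_closed A r F \<and> iso_closed A r C) \<and> reflective A r F \<and>
    coreflective A r C \<and> ?four \<and> ?five"
  \<comment> \<open>Necessity and the homotopy category are treated together for an arbitrary model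
    structure, since both rest on the same choice of replacements.\<close>
  have model: "?conditions \<and> is_equivalence (preorder_cat (F \<inter> C) (Restr r (F \<inter> C)))
      (localization K we) (comp_functor (localization_functor K we) inclusion_functor)"
    if model: "model_structure K cof we fib" and F: "fibrant_objects K fib = F"
      and C: "cofibrant_objects K cof = C" for cof we fib
  proof -
    interpret preorder_model A r cof we fib by standard (fact model)
    obtain \<rho> \<kappa> where
      "\<And>x. x \<in> A \<Longrightarrow> \<rho> x \<in> fibrant_objects K fib \<and> (x, \<rho> x) \<in> cof \<inter> we"
      "\<And>x. x \<in> A \<Longrightarrow> \<kappa> x \<in> cofibrant_objects K cof \<and> (\<kappa> x, x) \<in> we \<inter> fib"
      using ex_replacements by blast
    then interpret preorder_model_replacements A r cof we fib \<rho> \<kappa> by unfold_locales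
    have "?four" using minimal_maximal_iff commute unfolding F C by blast
    moreover have "?five" using interpolation_iff interpolation unfolding F C by blast
    moreover have "reflective A r F" "coreflective A r C"
      using reflection coreflection unfolding F C reflective_def coreflective_def by blast+
    ultimately show ?thesis
      using iso_closed_fibrant iso_closed_cofibrant homotopy_category unfolding F C by blast
  qed
  have "\<exists>cof we fib. model_structure K cof we fib \<and> fibrant_objects K fib = F \<and>
      cofibrant_objects K cof = C" if conditions: "?conditions"
  proof -
    \<comment> \<open>With pointwise choices of reflections and coreflections, \<open>?four\<close>
      and \<open>?five\<close> become the hypotheses \<open>commute\<close> and
      \<open>interpolation\<close> of \<open>ex_model_structure\<close>.\<close>
    obtain \<rho> \<kappa> where "\<forall>x\<in>A. is_least r (upper_bounds_in r F x) (\<rho> x)"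
      "\<forall>x\<in>A. is_greatest r (lower_bounds_in r C x) (\<kappa> x)"
      using conditions unfolding reflective_def coreflective_def by metis
    then interpret reflection_pair A r F C \<rho> \<kappa>
      by unfold_locales (use assms in auto)
    show ?thesis
      using conditions ex_model_structure unfolding minimal_maximal_iff interpolation_iff by blast
  qed
  with model show ?thesis by blast
qed
end
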